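(* Let $\mathbb{H}$ be a separable Hilbert space and let $X_1,X_2,\dots$ be independent random compact self-adjoint operators on $\mathbb{H}$ such that, for constants $c,B>0$ and all $i$, $\|X_i\|\le c$ and $\operatorname{tr}(X_i^2)\le B$ almost surely, and such that for all $i$ (with operators $\mu,\Sigma,\Sigma'$ not depending on $i$) $\mathbb{E}X_i=\mu$, $\mathbb{V}X_i=\Sigma$, $\mathbb{V}[(X_i-\mu)^2-\Sigma]=\Sigma'$, with $\Sigma\neq0$. For $n\ge8$ a multiple of $4$ and $\delta_1,\delta_2,\delta_3\in(0,1)$, with $\tau_u(\delta_2)$ and $\sigma_u^2(\delta_3)$ the empirical quantities (computed from $X_1,\dots,X_n$) defined in the context and $\sigma_u(\delta_3)=\sqrt{\sigma_u^2(\delta_3)}$, define $$R_n(\delta_1,\delta_2,\delta_3):=\sigma_u(\delta_3)\sqrt{\frac2n\log\left(\frac{2}{\delta_1}\left[\frac{\tau_u(\delta_2)}{\sigma_u^2(\delta_3)}\vee1\right]\right)}+\frac{2c}{3n}\log\left(\frac{2}{\delta_1}\left[\frac{\tau_u(\delta_2)}{\sigma_u^2(\delta_3)}\vee1\right]\right).$$ Let $\delta\in(0,1)$ and put $\delta_{1,n}:=(n-2)\delta/n$, $\delta_{2,n}:=\delta/n$, $\delta_{3,n}:=\delta/n$. Then, as $n\to\infty$ along multiples of $4$, $$\sqrt n\,R_n(\delta_{1,n},\delta_{2,n},\delta_{3,n})\ \longrightarrow\ \sqrt{2\|\Sigma\|\log\left(\frac2\delta\,\frac{\operatorname{tr}(\Sigma)}{\|\Sigma\|}\right)}\qquad\text{almost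 surely.}$$
   Context: $\|\cdot\|$ is the operator norm, $\operatorname{tr}$ the trace, $a\vee b=\max(a,b)$, and $\mathbb{V}X:=\mathbb{E}(X-\mathbb{E}X)^2$ for a random self-adjoint operator $X$. Auxiliary operators: for $i=1,\dots,n/2$, $X_i':=\tfrac12(X_{2i-1}-X_{2i})^2$; for $i=1,\dots,n/4$, $X_i'':=\tfrac12(X_{2i-1}'-X_{2i}')^2$. Put $\Sigma_n:=\frac2n\sum_{i=1}^{n/2}X_i'$ and $\Sigma_n':=\frac4n\sum_{i=1}^{n/4}X_i''$. Scalar sample variance: for real $\mathbf{Z}=(Z_1,\dots,Z_m)$, $\varsigma_m^2(\mathbf{Z}):=\frac{1}{m(m-1)}\sum_{1\le i<j\le m}(Z_i-Z_j)^2$. With $Z_i=\operatorname{tr}(X_i')$ ($i\le n/2$) and $Z_i'=\operatorname{tr}(X_i'')$ ($i\le n/4$), $$\tau_u(\delta):=\operatorname{tr}(\Sigma_n)+\varsigma_{n/2}(\mathbf{Z})\sqrt{\frac{2\log(2/\delta)}{n/2}}+\frac{7(2B)\log(2/\delta)}{3(n/2-1)},$$ $$\tau_u'(\delta):=\operatorname{tr}(\Sigma_n')+\varsigma_{n/4}(\mathbf{Z}')\sqrt{\frac{2\log(2/\delta)}{n/4}}+\frac{7(4Bc^2)\log(2/\delta)}{3(n/4-1)}.$$ Further, for $\tau\ge0$, $$\Gamma_{c,\delta}(\tau):=\sqrt{\frac{2\tau}{n/2}\log(2/\delta)}+\frac{2c^2}{3(n/2)}\log(2/\delta),\qquad \sigma_u^2(\tau;\delta):=\|\Sigma_n\|+\Gamma_{c,\delta}(\tau),$$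 and $$\sigma_u^2(\delta_3):=\sigma_u^2\!\left(\tau_u'(\delta_3/2);\,\delta_3/2\right).$$ *)

theory Defs
  imports "HOL-Probability.Probability"
begin

section \<open>Separable Hilbert spaces over the reals or the complex numbers\<close>

text \<open>
  The library only has real inner products.  Both scalar fields are covered at once here: the
  type carries the underlying real Hilbert space structure (norm, topology, completeness,
  separability), and \<open>K\<close>, \<open>scale\<close>, \<open>ip\<close> add the scalar field
  (all of the complex numbers, or the reals inside them), its action, and the inner product,
  linear in the first argument.  The values of \<open>scale\<close> outside \<open>K\<close> are
  irrelevant.  The last assumption ties \<open>ip\<close> to the norm of the type.
\<close>

locale separable_hilbert_space =
  fixes K :: "complex set"
    and scale :: "complex \<Rightarrow> 'a \<Rightarrow> 'a::{real_inner, banach, second_countable_topology}"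
    and ip :: "'a \<Rightarrow> 'a \<Rightarrow> complex"
  assumes scalars: "K = \<real> \<or> K = UNIV"
    and scale_of_real: "scale (of_real r) x = r *\<^sub>R x"
    and scale_add_right: "a \<in> K \<Longrightarrow> scale a (x + y) = scale a x + scale a y"
    and scale_add_left: "a \<in> K \<Longrightarrow> b \<in> K \<Longrightarrow> scale (a + b) x = scale a x + scale b x"
    and scale_scale: "a \<in> K \<Longrightarrow> b \<in> K \<Longrightarrow> scale a (scale b x) = scale (a * b) x"
    and ip_in_scalars: "ip x y \<in> K"
    and ip_commute: "ip y x = cnj (ip x y)"
    and ip_add_left: "ip (x + y) z = ip x z + ip y z"
    and ip_scale_left: "a \<in> K \<Longrightarrow> ip (scale a x) y = a * ip x y"
    and Re_ip: "Re (ip x y) = x \<bullet> y"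

lemma separable_hilbert_space_real:
  "separable_hilbert_space \<real> (\<lambda>a x. Re a *\<^sub>R x)
     (\<lambda>x y :: 'a::{real_inner, banach, second_countable_topology}. of_real (x \<bullet> y))"
  by unfold_locales (auto simp: algebra_simps inner_commute elim!: Reals_cases)

lemma separable_hilbert_space_complex:
  "separable_hilbert_space UNIV (*) (\<lambda>x y :: complex. x * cnj y)"
  by unfold_locales (auto simp: algebra_simps scaleR_conv_of_real inner_complex_def)

definition orthonormal_set :: "('a \<Rightarrow> 'a \<Rightarrow> complex) \<Rightarrow> 'a set \<Rightarrow> bool" where
  "orthonormal_set ip E \<longleftrightarrow> (\<forall>e\<in>E. \<forall>f\<in>E. ip e f = (if e = f then 1 else 0))"

definition orthonormal_basis :: "('a::real_vector \<Rightarrow> 'a \<Rightarrow> complex) \<Rightarrow> 'a set \<Rightarrow> bool" where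
  "orthonormal_basis ip E \<longleftrightarrow>
     orthonormal_set ip E \<and> (\<forall>x. (\<forall>e\<in>E. ip x e = 0) \<longrightarrow> x = 0)"

lemma (in separable_hilbert_space) orthonormal_basis_exists: "\<exists>E. orthonormal_basis ip E"
proof -
  have "\<exists>E\<in>{E. orthonormal_set ip E}. \<forall>F\<in>{E. orthonormal_set ip E}. E \<subseteq> F \<longrightarrow> F = E"
  proof (rule subset_Zorn')
    fix C assume C: "subset.chain {E. orthonormal_set ip E} C"
    show "\<Union>C \<in> {E. orthonormal_set ip E}"
      unfolding mem_Collect_eq orthonormal_set_def
    proof (intro ballI)
      fix e f assume "e \<in> \<Union>C" "f \<in> \<Union>C"
      then obtain A B where AB: "e \<in> A" "A \<in> C" "f \<in> B" "B \<in> C" by blast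
      then have "A \<subseteq> B \<or> B \<subseteq> A" using C by (auto simp: subset_chain_def)
      then obtain D where "D \<in> C" "e \<in> D" "f \<in> D" using AB by blast
      moreover from this have "orthonormal_set ip D" using C by (auto simp: subset_chain_def)
      ultimately show "ip e f = (if e = f then 1 else 0)" by (auto simp: orthonormal_set_def)
    qed
  qed
  then obtain E where E: "orthonormal_set ip E"
    and E_max: "\<And>F. orthonormal_set ip F \<Longrightarrow> E \<subseteq> F \<Longrightarrow> F = E" by auto
  have "x = 0" if x: "\<forall>e\<in>E. ip x e = 0" for x
  proof (rule ccontr)
    assume "x \<noteq> 0"
    define u where "u = scale (of_real (inverse (norm x))) x"
    have real_in: "of_real r \<in> K" for r using scalars by auto
    have self: "ip y y = of_real (y \<bullet> y)" for y
    proof -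
      have "Im (ip y y) = 0" using arg_cong[OF ip_commute[of y y], of Im] by simp
      then show ?thesis by (simp add: complex_eq_iff Re_ip)
    qed
    have "u = inverse (norm x) *\<^sub>R x" by (simp only: u_def scale_of_real)
    then have "norm u = 1" using \<open>x \<noteq> 0\<close> by simp
    then have uu: "ip u u = 1" by (simp add: self dot_square_norm)
    have ue: "ip u e = 0" if "e \<in> E" for e
      using x that real_in unfolding u_def by (simp only: ip_scale_left) simp
    have eu: "ip e u = 0" if "e \<in> E" for e
      using ue[OF that] ip_commute[of e u] by simp
    have "orthonormal_set ip (insert u E)"
      using E uu ue eu unfolding orthonormal_set_def by (metis insert_iff)
    then have "u \<in> E" using E_max[of "insert u E"] by blast
    then show False using ue uu by force
  qed
  then show ?thesis using E unfolding orthonormal_basis_def by blast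
qed


section \<open>Operators\<close>

text \<open>
  Bounded operators are elements of \<open>'a \<Rightarrow>\<^sub>L 'a\<close>, whose norm is the operator
  norm.  The type only imposes linearity over the reals; an operator that is self-adjoint with
  respect to \<open>ip\<close> is automatically linear over \<open>K\<close>.
\<close>

definition selfadjoint_op ::
    "('a \<Rightarrow> 'a \<Rightarrow> complex) \<Rightarrow> ('a::real_normed_vector \<Rightarrow>\<^sub>L 'a) \<Rightarrow> bool" where
  "selfadjoint_op ip A \<longleftrightarrow> (\<forall>x y. ip (blinfun_apply A x) y = ip x (blinfun_apply A y))"

lemma (in separable_hilbert_space) selfadjoint_op_scale:
  assumes "selfadjoint_op ip A" "a \<in> K"
  shows "blinfun_apply A (scale a x) = scale a (blinfun_apply A x)"
proof -
  let ?d = "blinfun_apply A (scale a x) - scale a (blinfun_apply A x)"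
  have "ip (blinfun_apply A (scale a x)) y = ip (scale a (blinfun_apply A x)) y" for y
    using assms by (simp add: selfadjoint_op_def ip_scale_left)
  then have "blinfun_apply A (scale a x) \<bullet> y = scale a (blinfun_apply A x) \<bullet> y" for y
    using Re_ip by metis
  then have "?d \<bullet> ?d = 0" by (simp only: inner_diff_left)
  then show ?thesis by simp
qed

definition compact_op :: "('a::real_normed_vector \<Rightarrow>\<^sub>L 'a) \<Rightarrow> bool" where
  "compact_op A \<longleftrightarrow> compact (closure (blinfun_apply A ` cball 0 1))"

definition op_sq :: "('a::real_normed_vector \<Rightarrow>\<^sub>L 'a) \<Rightarrow> 'a \<Rightarrow>\<^sub>L 'a" where
  "op_sq A = A o\<^sub>L A"

text \<open>
  The trace of a nonnegative self-adjoint operator, as an element of \<open>[0,\<infinity>]\<close>; it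
  does not depend on the orthonormal basis.  It is used for nonnegative operators only.
  \<open>op_tr\<close> is its real value when the trace is finite.
\<close>

definition ext_trace ::
    "('a \<Rightarrow> 'a \<Rightarrow> complex) \<Rightarrow> ('a::real_normed_vector \<Rightarrow>\<^sub>L 'a) \<Rightarrow> ennreal" where
  "ext_trace ip A =
     (\<Sum>\<^sub>\<infinity>e\<in>(SOME E. orthonormal_basis ip E). ennreal (Re (ip (blinfun_apply A e) e)))"

definition op_tr ::
    "('a \<Rightarrow> 'a \<Rightarrow> complex) \<Rightarrow> ('a::real_normed_vector \<Rightarrow>\<^sub>L 'a) \<Rightarrow> real" where
  "op_tr ip A = enn2real (ext_trace ip A)"

text \<open>
  The library's Bochner integral needs a second-countable target, which the space of bounded
  operators is not.  The expectation of a random operator is therefore the operator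
  \<open>u \<mapsto> E (X u)\<close>, with a Bochner integral in the Hilbert space.  For almost surely
  bounded, compact-operator-valued \<open>X\<close> this agrees with the Bochner integral in operator
  norm.
\<close>

definition op_expectation ::
    "'w measure \<Rightarrow> ('w \<Rightarrow> 'a \<Rightarrow>\<^sub>L 'a::{banach, second_countable_topology}) \<Rightarrow> 'a \<Rightarrow>\<^sub>L 'a" where
  "op_expectation M X = Blinfun (\<lambda>u. \<integral>\<omega>. blinfun_apply (X \<omega>) u \<partial>M)"

definition op_variance ::
    "'w measure \<Rightarrow> ('w \<Rightarrow> 'a \<Rightarrow>\<^sub>L 'a::{banach, second_countable_topology}) \<Rightarrow> 'a \<Rightarrow>\<^sub>L 'a" where
  "op_variance M X = op_expectation M (\<lambda>\<omega>. op_sq (X \<omega> - op_expectation M X))"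


section \<open>The empirical quantities\<close>

text \<open>
  These are functions of the observed sequence \<open>x 1, x 2, \<dots>\<close>; only
  \<open>x 1, \<dots>, x n\<close> enter.  The sample size \<open>n\<close> is meant to be a multiple of 4.
\<close>

definition paired :: "(nat \<Rightarrow> 'a \<Rightarrow>\<^sub>L 'a::real_normed_vector) \<Rightarrow> nat \<Rightarrow> 'a \<Rightarrow>\<^sub>L 'a" where
  "paired x i = (1/2) *\<^sub>R op_sq (x (2 * i - 1) - x (2 * i))"

definition Sigma_hat :: "nat \<Rightarrow> (nat \<Rightarrow> 'a \<Rightarrow>\<^sub>L 'a::real_normed_vector) \<Rightarrow> 'a \<Rightarrow>\<^sub>L 'a" where
  "Sigma_hat n x = (2 / real n) *\<^sub>R (\<Sum>i = 1..n div 2. paired x i)"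

definition Sigma_hat' :: "nat \<Rightarrow> (nat \<Rightarrow> 'a \<Rightarrow>\<^sub>L 'a::real_normed_vector) \<Rightarrow> 'a \<Rightarrow>\<^sub>L 'a" where
  "Sigma_hat' n x = (4 / real n) *\<^sub>R (\<Sum>i = 1..n div 4. paired (paired x) i)"

definition sample_variance :: "nat \<Rightarrow> (nat \<Rightarrow> real) \<Rightarrow> real" where
  "sample_variance m Z =
     1 / (real m * (real m - 1)) *
       (\<Sum>(i, j)\<in>{(i, j). 1 \<le> i \<and> i < j \<and> j \<le> m}. (Z i - Z j)\<^sup>2)"

definition sample_sd :: "nat \<Rightarrow> (nat \<Rightarrow> real) \<Rightarrow> real" where
  "sample_sd m Z = sqrt (sample_variance m Z)"

definition tau_u ::
    "('a \<Rightarrow> 'a \<Rightarrow> complex) \<Rightarrow> real \<Rightarrow> nat \<Rightarrow> (nat \<Rightarrow> 'a \<Rightarrow>\<^sub>L 'a::real_normed_vector) \<Rightarrow> real \<Rightarrow> real" where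
  "tau_u ip B n x \<delta> =
     op_tr ip (Sigma_hat n x)
     + sample_sd (n div 2) (\<lambda>i. op_tr ip (paired x i)) * sqrt (2 * ln (2 / \<delta>) / (real n / 2))
     + 7 * (2 * B) * ln (2 / \<delta>) / (3 * (real n / 2 - 1))"

definition tau_u' ::
    "('a \<Rightarrow> 'a \<Rightarrow> complex) \<Rightarrow> real \<Rightarrow> real \<Rightarrow> nat \<Rightarrow> (nat \<Rightarrow> 'a \<Rightarrow>\<^sub>L 'a::real_normed_vector) \<Rightarrow> real \<Rightarrow> real" where
  "tau_u' ip B c n x \<delta> =
     op_tr ip (Sigma_hat' n x)
     + sample_sd (n div 4) (\<lambda>i. op_tr ip (paired (paired x) i)) * sqrt (2 * ln (2 / \<delta>) / (real n / 4))
     + 7 * (4 * B * c\<^sup>2) * ln (2 / \<delta>) / (3 * (real n / 4 - 1))"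

definition Gamma_dev :: "real \<Rightarrow> nat \<Rightarrow> real \<Rightarrow> real \<Rightarrow> real" where
  "Gamma_dev c n \<delta> \<tau> =
     sqrt (2 * \<tau> / (real n / 2) * ln (2 / \<delta>)) + 2 * c\<^sup>2 / (3 * (real n / 2)) * ln (2 / \<delta>)"

definition sigma_u_sq_at ::
    "real \<Rightarrow> nat \<Rightarrow> (nat \<Rightarrow> 'a \<Rightarrow>\<^sub>L 'a::real_normed_vector) \<Rightarrow> real \<Rightarrow> real \<Rightarrow> real" where
  "sigma_u_sq_at c n x \<tau> \<delta> = norm (Sigma_hat n x) + Gamma_dev c n \<delta> \<tau>"

definition sigma_u_sq ::
    "('a \<Rightarrow> 'a \<Rightarrow> complex) \<Rightarrow> real \<Rightarrow> real \<Rightarrow> nat \<Rightarrow> (nat \<Rightarrow> 'a \<Rightarrow>\<^sub>L 'a::real_normed_vector) \<Rightarrow> real \<Rightarrow> real" where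
  "sigma_u_sq ip B c n x \<delta>3 = sigma_u_sq_at c n x (tau_u' ip B c n x (\<delta>3 / 2)) (\<delta>3 / 2)"

definition R_bound ::
    "('a \<Rightarrow> 'a \<Rightarrow> complex) \<Rightarrow> real \<Rightarrow> real \<Rightarrow> nat \<Rightarrow> (nat \<Rightarrow> 'a \<Rightarrow>\<^sub>L 'a::real_normed_vector)
      \<Rightarrow> real \<Rightarrow> real \<Rightarrow> real \<Rightarrow> real" where
  "R_bound ip B c n x \<delta>1 \<delta>2 \<delta>3 =
     (let s2 = sigma_u_sq ip B c n x \<delta>3;
          L = ln (2 / \<delta>1 * max (tau_u ip B n x \<delta>2 / s2) 1)
      in sqrt s2 * sqrt (2 / real n * L) + 2 * c / (3 * real n) * L)"

end

theory Submission
  imports Defs "HOL-Real_Asymp.Real_Asymp"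
begin

text \<open>
  Multiplied by \<open>sqrt n\<close>, the bound is a continuous function of two statistics, the norm
  and the trace of the paired sample variance \<open>Sigma_hat n\<close>, up to corrections.  The
  corrections vanish whenever the observations satisfy the almost sure bounds: then the traces of
  all paired squares are bounded, hence so are their sample variances, and
  \<open>ln (n / \<delta>) / n\<close> tends to 0 (\<open>R_bound_tendsto\<close>).  Since \<open>S \<noteq> 0\<close> is positive,
  \<open>norm S \<le> op_tr ip S\<close>, so the maximum with 1 inside the logarithm disappears in
  the limit.  What remains is the almost sure convergence of the norm and of the trace of
  \<open>Sigma_hat n\<close> to those of \<open>S\<close>.

  \<open>Sigma_hat n\<close> is an average of independent positive operators with expectation
  \<open>S\<close>.  Instead of a law of large numbers in operator norm, only countably many scalar
  laws are used: one for the traces, and one for each entry with respect to the countable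
  orthonormal basis that defines the trace.  The summands are bounded, independent and have equal
  means, though not necessarily equal distributions, so Hoeffding's inequality and the
  Borel-Cantelli lemma give these laws (\<open>strong_law_bounded\<close>).

  Convergence of entries and traces of positive operators implies convergence of norms
  (\<open>norm_tendsto_if_entries_and_trace_tendsto\<close>), since no mass can escape to infinity.
  Quantitatively, for positive operators \<open>A\<close>, \<open>B\<close> and a finite set
  \<open>F\<close> of basis vectors, \<open>sqrt (norm A)\<close> exceeds
  \<open>sqrt (norm B + d)\<close> by at most the square root of the trace of \<open>A\<close>
  outside \<open>F\<close>, where \<open>d\<close> is the sum of the moduli of the entries of
  \<open>A - B\<close> in \<open>F\<close> (\<open>positive_op_norm_compare\<close>).  This rests on
  the seminorm \<open>x \<mapsto> sqrt (A x \<bullet> x)\<close> and on Cauchy-Schwarz for the expansion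
  of a vector in the basis.
\<close>


section \<open>Orthonormal expansions over the scalar field\<close>

context separable_hilbert_space
begin

lemma of_real_in_scalars: "of_real r \<in> K"
  using scalars by auto

lemma ip_scaleR_left: "ip (r *\<^sub>R x) y = of_real r * ip x y"
  using ip_scale_left[OF of_real_in_scalars, of r x y] by (simp add: scale_of_real)

lemma ip_zero_left: "ip 0 y = 0"
  using ip_scaleR_left[of 0 0 y] by simp

lemma ip_diff_left: "ip (x - y) z = ip x z - ip y z"
  using ip_add_left[of "x - y" y z] by simp

lemma ip_add_right: "ip z (x + y) = ip z x + ip z y"
  by (metis ip_commute ip_add_left complex_cnj_add)

lemma ip_scale_right: "a \<in> K \<Longrightarrow> ip y (scale a x) = cnj a * ip y x"
  by (metis ip_commute ip_scale_left complex_cnj_mult)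

lemma ip_zero_right: "ip y 0 = 0"
  using ip_commute[of y 0] by (simp add: ip_zero_left)

lemma ip_diff_right: "ip z (x - y) = ip z x - ip z y"
  by (metis ip_commute ip_diff_left complex_cnj_diff)

lemma ip_scaleR_right: "ip y (r *\<^sub>R x) = of_real r * ip y x"
  by (metis ip_commute ip_scaleR_left complex_cnj_mult complex_cnj_complex_of_real)

lemma ip_sum_left: "ip (\<Sum>i\<in>I. f i) y = (\<Sum>i\<in>I. ip (f i) y)"
  by (induction I rule: infinite_finite_induct) (auto simp: ip_zero_left ip_add_left)

lemma ip_sum_right: "ip y (\<Sum>i\<in>I. f i) = (\<Sum>i\<in>I. ip y (f i))"
  by (induction I rule: infinite_finite_induct) (auto simp: ip_zero_right ip_add_right)

lemma ip_self: "ip y y = of_real ((norm y)\<^sup>2)"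
proof -
  have "Im (ip y y) = 0" using arg_cong[OF ip_commute[of y y], of Im] by simp
  then show ?thesis by (simp add: complex_eq_iff Re_ip power2_norm_eq_inner)
qed

lemma Im_ip:
  assumes "K = UNIV"
  shows "Im (ip x y) = x \<bullet> scale \<i> y"
proof -
  have "ip x (scale \<i> y) = - \<i> * ip x y"
    using ip_scale_right[of \<i> x y] assms by simp
  then show ?thesis
    using Re_ip[of x "scale \<i> y"] by simp
qed

text \<open>
  Over the complex numbers the imaginary part of the scalar product is again a real scalar
  product, and over the reals it vanishes.  So real scalar products with a vector and its rotation
  by \<open>\<i>\<close> control the complex one, whichever the field.
\<close>

lemma cmod_ip_le: "cmod (ip x y) \<le> \<bar>x \<bullet> y\<bar> + \<bar>x \<bullet> scale \<i> y\<bar>"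
proof -
  have "\<bar>Im (ip x y)\<bar> \<le> \<bar>x \<bullet> scale \<i> y\<bar>"
  proof (cases "K = UNIV")
    case False
    then have "ip x y \<in> \<real>" using scalars ip_in_scalars by auto
    then show ?thesis by (auto elim!: Reals_cases)
  qed (simp add: Im_ip)
  then show ?thesis
    using cmod_le[of "ip x y"] by (simp add: Re_ip)
qed

lemma bounded_linear_ip_left: "bounded_linear (\<lambda>x. ip x y)"
proof (rule bounded_linear_intro[where K = "norm y + norm (scale \<i> y)"])
  show "norm (ip x y) \<le> norm x * (norm y + norm (scale \<i> y))" for x
    using cmod_ip_le[of x y] Cauchy_Schwarz_ineq2[of x y] Cauchy_Schwarz_ineq2[of x "scale \<i> y"]
    by (simp add: distrib_left)
qed (auto simp: ip_add_left ip_scaleR_left scaleR_conv_of_real)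

definition partial_expansion :: "'a set \<Rightarrow> 'a \<Rightarrow> 'a" where
  "partial_expansion F x = (\<Sum>e\<in>F. scale (ip x e) e)"

lemma ip_scale_coeff: "ip (scale (ip x e) e) y = ip x e * ip e y"
  by (simp add: ip_scale_left ip_in_scalars)

lemma orthonormal_basis_eqI:
  assumes "orthonormal_basis ip E" "\<And>e. e \<in> E \<Longrightarrow> ip x e = ip y e"
  shows "x = y"
  using assms by (metis orthonormal_basis_def ip_diff_left right_minus_eq)

context
  fixes E :: "'a set"
  assumes E: "orthonormal_set ip E"
begin

lemma ip_orthonormal: "e \<in> E \<Longrightarrow> f \<in> E \<Longrightarrow> ip e f = (if e = f then 1 else 0)"
  using E by (auto simp: orthonormal_set_def)

text \<open>The balls of radius 1/2 around the vectors are disjoint open sets.\<close>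

lemma orthonormal_set_countable: "countable E"
proof -
  have dist: "dist e f \<ge> 1" if "e \<in> E" "f \<in> E" "e \<noteq> f" for e f
  proof -
    have "complex_of_real ((norm (e - f))\<^sup>2) = of_real 2"
      unfolding ip_self[symmetric] using that by (simp add: ip_diff_left ip_diff_right ip_orthonormal)
    then have "(norm (e - f))\<^sup>2 = 2"
      using of_real_eq_iff by blast
    then have "(1::real)\<^sup>2 \<le> (norm (e - f))\<^sup>2" by simp
    then have "1 \<le> norm (e - f)"
      using power2_le_imp_le norm_ge_zero by blast
    then show ?thesis by (simp add: dist_norm)
  qed
  have inj: "inj_on (\<lambda>e. ball e (1/2)) E"
  proof (rule inj_onI)
    fix e f assume "e \<in> E" "f \<in> E" "ball e (1/2) = ball f (1/2::real)"
    then show "e = f"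
      using dist[of e f] centre_in_ball[of e "1/2"] by (force simp: dist_commute)
  qed
  have "disjnt (ball e (1/2)) (ball f (1/2))" if "e \<in> E" "f \<in> E" "e \<noteq> f" for e f :: 'a
    unfolding disjnt_iff
  proof (intro allI notI, elim conjE)
    fix x assume "x \<in> ball e (1/2)" "x \<in> ball f (1/2)"
    then show False using dist[OF that] dist_triangle2[of e f x] by (auto simp: dist_commute)
  qed
  then have "pairwise disjnt ((\<lambda>e. ball e (1/2)) ` E)"
    by (auto simp: pairwise_def)
  then have "countable ((\<lambda>e. ball e (1/2)) ` E)"
    by (intro countable_disjoint_open_subsets) auto
  then show ?thesis
    using inj countable_image_inj_on by blast
qed

lemma ip_partial_expansion:
  assumes "finite F" "F \<subseteq> E" "e \<in> E"
  shows "ip (partial_expansion F x) e = (if e \<in> F then ip x e else 0)"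
proof -
  have "ip (partial_expansion F x) e = (\<Sum>f\<in>F. ip x f * ip f e)"
    by (simp add: partial_expansion_def ip_sum_left ip_scale_coeff)
  also have "\<dots> = (\<Sum>f\<in>F. if f = e then ip x e else 0)"
    using assms by (intro sum.cong refl) (auto simp: ip_orthonormal)
  finally show ?thesis using assms by simp
qed

lemma norm_partial_expansion:
  assumes "finite F" "F \<subseteq> E"
  shows "(norm (partial_expansion F x))\<^sup>2 = (\<Sum>e\<in>F. (cmod (ip x e))\<^sup>2)"
proof -
  have "complex_of_real ((norm (partial_expansion F x))\<^sup>2)
      = (\<Sum>e\<in>F. cnj (ip x e) * ip (partial_expansion F x) e)"
    unfolding ip_self[symmetric]
    by (subst (2) partial_expansion_def) (simp add: ip_sum_right ip_scale_right ip_in_scalars)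
  also have "\<dots> = (\<Sum>e\<in>F. of_real ((cmod (ip x e))\<^sup>2))"
    using assms by (intro sum.cong refl)
      (subst ip_partial_expansion, auto simp: mult.commute simp flip: complex_norm_square)
  finally have "complex_of_real ((norm (partial_expansion F x))\<^sup>2)
      = complex_of_real (\<Sum>e\<in>F. (cmod (ip x e))\<^sup>2)" by simp
  then show ?thesis using of_real_eq_iff by blast
qed

lemma norm_minus_partial_expansion:
  assumes "finite F" "F \<subseteq> E"
  shows "(norm (x - partial_expansion F x))\<^sup>2 = (norm x)\<^sup>2 - (\<Sum>e\<in>F. (cmod (ip x e))\<^sup>2)"
proof -
  let ?p = "partial_expansion F x"
  have "ip (x - ?p) ?p = (\<Sum>e\<in>F. cnj (ip x e) * ip (x - ?p) e)"
    by (subst (2) partial_expansion_def) (simp add: ip_sum_right ip_scale_right ip_in_scalars)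
  also have "\<dots> = 0"
    using assms by (intro sum.neutral ballI) (simp add: ip_diff_left ip_partial_expansion subset_iff)
  finally have "(x - ?p) \<bullet> ?p = 0" using Re_ip by (metis zero_complex.simps(1))
  then have "(norm x)\<^sup>2 = (norm (x - ?p))\<^sup>2 + (norm ?p)\<^sup>2"
    by (simp add: power2_norm_eq_inner inner_diff inner_commute)
  then show ?thesis using norm_partial_expansion[OF assms] by simp
qed

lemma Bessel_inequality:
  assumes "finite F" "F \<subseteq> E"
  shows "(\<Sum>e\<in>F. (cmod (ip x e))\<^sup>2) \<le> (norm x)\<^sup>2"
  using norm_minus_partial_expansion[OF assms, of x] by (smt (verit) zero_le_power2)

lemma norm_minus_partial_expansion_le:
  assumes "finite F" "F \<subseteq> E"
  shows "norm (x - partial_expansion F x) \<le> norm x"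
proof -
  have "(norm (x - partial_expansion F x))\<^sup>2 \<le> (norm x)\<^sup>2"
    unfolding norm_minus_partial_expansion[OF assms] by (simp add: sum_nonneg)
  then show ?thesis by (rule power2_le_imp_le) simp
qed

end

text \<open>
  Along an exhaustion of the basis by finite sets the partial expansions are Cauchy, because
  their mutual distances are differences of the bounded increasing sums in Bessel's inequality;
  the limit has the same coefficients as \<open>x\<close> and is \<open>x\<close> by maximality of the basis.
\<close>

lemma partial_expansion_tendsto:
  assumes E: "orthonormal_basis ip E"
  obtains F :: "nat \<Rightarrow> 'a set" where "\<And>n. finite (F n)" "\<And>n. F n \<subseteq> E"
    "\<And>x. (\<lambda>n. partial_expansion (F n) x) \<longlonglongrightarrow> x"
proof -
  have ons: "orthonormal_set ip E" using E by (simp add: orthonormal_basis_def)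
  note cnt = orthonormal_set_countable[OF ons]
  define F where "F n = {e \<in> E. to_nat_on E e \<le> n}" for n
  have fin: "finite (F n)" for n
  proof (rule finite_imageD)
    show "finite (to_nat_on E ` F n)"
      by (rule finite_subset[of _ "{..n}"]) (auto simp: F_def)
    show "inj_on (to_nat_on E) (F n)"
      using inj_on_to_nat_on[OF cnt] by (rule inj_on_subset) (auto simp: F_def)
  qed
  have sub: "F n \<subseteq> E" for n by (auto simp: F_def)
  have mono: "F m \<subseteq> F n" if "m \<le> n" for m n using that by (auto simp: F_def)
  have "(\<lambda>n. partial_expansion (F n) x) \<longlonglongrightarrow> x" for x
  proof -
    let ?p = "\<lambda>n. partial_expansion (F n) x"
    define s where "s n = (\<Sum>e\<in>F n. (cmod (ip x e))\<^sup>2)" for n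
    have diff: "(norm (?p n - ?p m))\<^sup>2 = s n - s m" if "m \<le> n" for m n
    proof -
      have "?p n - ?p m = partial_expansion (F n - F m) x"
        unfolding partial_expansion_def using mono[OF that] fin by (simp add: sum_diff)
      moreover have "s n - s m = (\<Sum>e\<in>F n - F m. (cmod (ip x e))\<^sup>2)"
        unfolding s_def using mono[OF that] fin by (simp add: sum_diff)
      ultimately show ?thesis
        using norm_partial_expansion[OF ons, of "F n - F m" x] fin sub[of n] by auto
    qed
    have "incseq s"
      unfolding s_def incseq_def using mono fin by (auto intro!: sum_mono2)
    moreover have "s n \<le> (norm x)\<^sup>2" for n
      unfolding s_def using Bessel_inequality[OF ons fin sub] .
    ultimately obtain l where "s \<longlonglongrightarrow> l"
      using incseq_convergent by blast
    then have "Cauchy s" using LIMSEQ_imp_Cauchy by blast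
    have "Cauchy ?p"
    proof (rule CauchyI)
      fix d :: real assume "d > 0"
      then obtain N where N: "\<And>m n. m \<ge> N \<Longrightarrow> n \<ge> N \<Longrightarrow> norm (s m - s n) < d\<^sup>2"
        using \<open>Cauchy s\<close> by (meson CauchyD zero_less_power)
      have *: "norm (?p n - ?p m) < d" if "m \<ge> N" "n \<ge> m" for m n
      proof (rule power2_less_imp_less)
        show "(norm (?p n - ?p m))\<^sup>2 < d\<^sup>2"
          using diff[of m n] N[of n m] that by auto
      qed (use \<open>d > 0\<close> in auto)
      have "norm (?p m - ?p n) < d" if "m \<ge> N" "n \<ge> N" for m n
      proof (cases "m \<le> n")
        case True then show ?thesis using *[of m n] that by (simp add: norm_minus_commute)
      next
        case False then show ?thesis using *[of n m] that by simp
      qed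
      then show "\<exists>N. \<forall>m\<ge>N. \<forall>n\<ge>N. norm (?p m - ?p n) < d" by blast
    qed
    then obtain z where z: "?p \<longlonglongrightarrow> z" using Cauchy_convergent convergent_def by blast
    have "z = x"
    proof (rule orthonormal_basis_eqI[OF E])
      fix e assume e: "e \<in> E"
      have "(\<lambda>n. ip (?p n) e) \<longlonglongrightarrow> ip z e"
        by (rule bounded_linear.tendsto[OF bounded_linear_ip_left z])
      moreover have "\<forall>\<^sub>F n in sequentially. ip (?p n) e = ip x e"
        using eventually_ge_at_top[of "to_nat_on E e"]
        by eventually_elim (subst ip_partial_expansion[OF ons fin sub e], use e in \<open>simp add: F_def\<close>)
      ultimately have "(\<lambda>n. ip x e) \<longlonglongrightarrow> ip z e"
        by (blast intro: Lim_transform_eventually)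
      then show "ip z e = ip x e" by (metis LIMSEQ_const_iff)
    qed
    with z show ?thesis by simp
  qed
  with fin sub that show thesis by blast
qed


section \<open>Positive operators: the norm is controlled by finitely many entries and the trace\<close>

definition positive_op :: "('a \<Rightarrow>\<^sub>L 'a) \<Rightarrow> bool" where
  "positive_op A \<longleftrightarrow> selfadjoint_op ip A \<and> (\<forall>x. 0 \<le> blinfun_apply A x \<bullet> x)"

lemma selfadjoint_opD: "selfadjoint_op ip A \<Longrightarrow> blinfun_apply A x \<bullet> y = x \<bullet> blinfun_apply A y"
  unfolding selfadjoint_op_def by (metis Re_ip)

lemma positive_op_selfadjoint: "positive_op A \<Longrightarrow> selfadjoint_op ip A"
  and positive_op_nonneg: "positive_op A \<Longrightarrow> 0 \<le> blinfun_apply A x \<bullet> x"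
  by (auto simp: positive_op_def)

lemma positive_op_Cauchy_Schwarz:
  assumes "positive_op A"
  shows "\<bar>blinfun_apply A x \<bullet> y\<bar> \<le> sqrt (blinfun_apply A x \<bullet> x) * sqrt (blinfun_apply A y \<bullet> y)"
proof -
  let ?a = "blinfun_apply A x \<bullet> x" and ?b = "blinfun_apply A x \<bullet> y" and ?c = "blinfun_apply A y \<bullet> y"
  have sym: "blinfun_apply A y \<bullet> x = ?b"
    using selfadjoint_opD[OF positive_op_selfadjoint[OF assms], of x y] by (simp add: inner_commute)
  have "0 \<le> blinfun_apply A (x + t *\<^sub>R y) \<bullet> (x + t *\<^sub>R y)" for t
    by (rule positive_op_nonneg[OF assms])
  then have quad: "0 \<le> ?a + 2 * t * ?b + t\<^sup>2 * ?c" for t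
    by (simp add: blinfun.bilinear_simps inner_add sym algebra_simps power2_eq_square)
  have "?b\<^sup>2 \<le> ?a * ?c"
  proof (cases "?c = 0")
    case True
    have "?b = 0"
    proof (rule ccontr)
      assume "?b \<noteq> 0"
      then show False using quad[of "- (?a + 1) / (2 * ?b)"] True positive_op_nonneg[OF assms, of x] by (simp add: field_simps)
    qed
    with True show ?thesis by simp
  next
    case False
    then have c: "?c > 0" using positive_op_nonneg[OF assms, of y] by simp
    then have "?a + 2 * (- ?b / ?c) * ?b + (- ?b / ?c)\<^sup>2 * ?c = ?a - ?b\<^sup>2 / ?c"
      by (simp add: power_divide power2_eq_square)
    then have "?b\<^sup>2 / ?c \<le> ?a" using quad[of "- ?b / ?c"] by linarith
    then show ?thesis using c by (simp add: pos_divide_le_eq)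
  qed
  then show ?thesis
    by (metis real_sqrt_abs real_sqrt_le_iff real_sqrt_mult)
qed

lemma positive_op_seminorm_triangle:
  assumes "positive_op A"
  shows "sqrt (blinfun_apply A (x + y) \<bullet> (x + y))
    \<le> sqrt (blinfun_apply A x \<bullet> x) + sqrt (blinfun_apply A y \<bullet> y)"
proof (rule real_le_lsqrt)
  have sym: "blinfun_apply A y \<bullet> x = blinfun_apply A x \<bullet> y"
    using selfadjoint_opD[OF positive_op_selfadjoint[OF assms], of x y] by (simp add: inner_commute)
  have "blinfun_apply A (x + y) \<bullet> (x + y)
      = blinfun_apply A x \<bullet> x + 2 * (blinfun_apply A x \<bullet> y) + blinfun_apply A y \<bullet> y"
    by (simp add: blinfun.bilinear_simps inner_add sym)
  also have "\<dots> \<le> (sqrt (blinfun_apply A x \<bullet> x) + sqrt (blinfun_apply A y \<bullet> y))\<^sup>2"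
    using positive_op_Cauchy_Schwarz[OF assms, of x y] positive_op_nonneg[OF assms]
    by (simp add: power2_sum)
  finally show "blinfun_apply A (x + y) \<bullet> (x + y)
    \<le> (sqrt (blinfun_apply A x \<bullet> x) + sqrt (blinfun_apply A y \<bullet> y))\<^sup>2" .
qed (use positive_op_nonneg[OF assms] in auto)

lemma positive_op_seminorm_sum:
  assumes "positive_op A"
  shows "sqrt (blinfun_apply A (\<Sum>i\<in>I. f i) \<bullet> (\<Sum>i\<in>I. f i))
    \<le> (\<Sum>i\<in>I. sqrt (blinfun_apply A (f i) \<bullet> f i))"
proof (induction I rule: infinite_finite_induct)
  case (insert i I)
  then show ?case
    using positive_op_seminorm_triangle[OF assms, of "f i" "\<Sum>i\<in>I. f i"] by simp
qed (auto simp: blinfun.bilinear_simps)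

lemma positive_op_scale:
  assumes "positive_op A" "a \<in> K"
  shows "blinfun_apply A (scale a x) \<bullet> scale a x = (cmod a)\<^sup>2 * (blinfun_apply A x \<bullet> x)"
proof -
  have "ip (blinfun_apply A (scale a x)) (scale a x) = a * cnj a * ip (blinfun_apply A x) x"
    using assms selfadjoint_op_scale[of A a x]
    by (simp add: positive_op_def ip_scale_left ip_scale_right)
  then show ?thesis
    unfolding Re_ip[symmetric] by (simp flip: complex_norm_square of_real_power)
qed

lemma quadratic_form_le_norm: "blinfun_apply A x \<bullet> x \<le> norm A * (norm x)\<^sup>2"
proof -
  have "blinfun_apply A x \<bullet> x \<le> norm (blinfun_apply A x) * norm x"
    using Cauchy_Schwarz_ineq2[of "blinfun_apply A x" x] by simp
  also have "\<dots> \<le> norm A * norm x * norm x"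
    by (intro mult_right_mono norm_blinfun) auto
  finally show ?thesis by (simp add: power2_eq_square mult.assoc)
qed

text \<open>Cauchy-Schwarz for the form of \<open>A\<close>, applied to \<open>x\<close> and \<open>A x\<close>.\<close>

lemma positive_op_norm_le:
  assumes A: "positive_op A" and C: "\<And>x. norm x \<le> 1 \<Longrightarrow> blinfun_apply A x \<bullet> x \<le> C"
  shows "norm A \<le> C"
proof -
  have C0: "0 \<le> C" using C[of 0] by simp
  have C': "blinfun_apply A x \<bullet> x \<le> C * (norm x)\<^sup>2" for x
  proof (cases "x = 0")
    case False
    then have "blinfun_apply A ((1 / norm x) *\<^sub>R x) \<bullet> ((1 / norm x) *\<^sub>R x) \<le> C"
      by (intro C) simp
    then show ?thesis using False
      by (simp add: blinfun.bilinear_simps field_simps power2_eq_square)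
  qed simp
  have C'': "sqrt (blinfun_apply A x \<bullet> x) \<le> sqrt C * norm x" for x
  proof -
    have "sqrt (blinfun_apply A x \<bullet> x) \<le> sqrt (C * (norm x)\<^sup>2)" using C' by simp
    then show ?thesis by (simp add: real_sqrt_mult)
  qed
  show ?thesis
  proof (rule norm_blinfun_bound[OF C0])
    fix x
    let ?y = "blinfun_apply A x"
    have "(norm ?y)\<^sup>2 = \<bar>blinfun_apply A x \<bullet> ?y\<bar>" by (simp add: power2_norm_eq_inner)
    also have "\<dots> \<le> sqrt (blinfun_apply A x \<bullet> x) * sqrt (blinfun_apply A ?y \<bullet> ?y)"
      by (rule positive_op_Cauchy_Schwarz[OF A])
    also have "\<dots> \<le> (sqrt C * norm x) * (sqrt C * norm ?y)"
      using positive_op_nonneg[OF A] C0 by (intro mult_mono C'') auto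
    also have "\<dots> = (C * norm x) * norm ?y" using C0 by simp
    finally have "norm ?y * norm ?y \<le> (C * norm x) * norm ?y"
      by (simp add: power2_eq_square)
    then show "norm ?y \<le> C * norm x"
      using C0 by (cases "?y = 0") auto
  qed
qed

lemma positive_op_sum:
  assumes "\<And>i. i \<in> I \<Longrightarrow> positive_op (A i)"
  shows "positive_op (\<Sum>i\<in>I. A i)"
  using assms unfolding positive_op_def selfadjoint_op_def
  by (auto simp: blinfun.sum_left ip_sum_left ip_sum_right inner_sum_left intro!: sum_nonneg)

lemma positive_op_scaleR: "positive_op A \<Longrightarrow> 0 \<le> r \<Longrightarrow> positive_op (r *\<^sub>R A)"
  unfolding positive_op_def selfadjoint_op_def
  by (auto simp: blinfun.bilinear_simps ip_scaleR_left ip_scaleR_right)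

lemma selfadjoint_op_diff: "selfadjoint_op ip A \<Longrightarrow> selfadjoint_op ip B \<Longrightarrow> selfadjoint_op ip (A - B)"
  unfolding selfadjoint_op_def by (simp add: blinfun.bilinear_simps ip_diff_left ip_diff_right)

lemma op_sq_inner:
  "selfadjoint_op ip A \<Longrightarrow> blinfun_apply (op_sq A) x \<bullet> y = blinfun_apply A x \<bullet> blinfun_apply A y"
  using selfadjoint_opD[of A "blinfun_apply A x" y] by (simp add: op_sq_def)

lemma positive_op_sq: "selfadjoint_op ip A \<Longrightarrow> positive_op (op_sq A)"
  unfolding positive_op_def by (simp add: op_sq_inner) (simp add: selfadjoint_op_def op_sq_def)

text \<open>
  The seminorm of \<open>A\<close> is subadditive along the expansion of \<open>y\<close>, and the scalar
  Cauchy-Schwarz inequality separates the coefficients of \<open>y\<close> from the diagonal entries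
  of \<open>A\<close>.
\<close>

lemma positive_op_tail:
  assumes E: "orthonormal_basis ip E" and A: "positive_op A"
    and tail: "\<And>G. finite G \<Longrightarrow> G \<subseteq> E - F \<Longrightarrow> (\<Sum>e\<in>G. blinfun_apply A e \<bullet> e) \<le> T"
    and y: "\<And>e. e \<in> F \<Longrightarrow> ip y e = 0"
  shows "blinfun_apply A y \<bullet> y \<le> T * (norm y)\<^sup>2"
proof -
  have ons: "orthonormal_set ip E" using E by (simp add: orthonormal_basis_def)
  obtain G where fin: "\<And>n. finite (G n)" and sub: "\<And>n. G n \<subseteq> E"
    and lim: "\<And>x. (\<lambda>n. partial_expansion (G n) x) \<longlonglongrightarrow> x"
    using partial_expansion_tendsto[OF E] by blast
  let ?p = "\<lambda>n. partial_expansion (G n) y"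
  have "blinfun_apply A (?p n) \<bullet> ?p n \<le> T * (norm y)\<^sup>2" for n
  proof -
    let ?q = "\<lambda>e. sqrt (blinfun_apply A e \<bullet> e)"
    let ?H = "G n - F"
    have "?q (?p n) \<le> (\<Sum>e\<in>G n. ?q (scale (ip y e) e))"
      unfolding partial_expansion_def by (rule positive_op_seminorm_sum[OF A])
    also have "\<dots> = (\<Sum>e\<in>G n. cmod (ip y e) * ?q e)"
      by (simp add: positive_op_scale[OF A ip_in_scalars] real_sqrt_mult)
    also have "\<dots> = (\<Sum>e\<in>?H. cmod (ip y e) * ?q e)"
      using fin y by (intro sum.mono_neutral_right) auto
    finally have "(?q (?p n))\<^sup>2 \<le> (\<Sum>e\<in>?H. cmod (ip y e) * ?q e)\<^sup>2"
      using positive_op_nonneg[OF A] by (intro power_mono) auto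
    also have "\<dots> \<le> (\<Sum>e\<in>?H. (cmod (ip y e))\<^sup>2) * (\<Sum>e\<in>?H. (?q e)\<^sup>2)"
      by (rule Cauchy_Schwarz_ineq_sum)
    also have "\<dots> \<le> (norm y)\<^sup>2 * T"
      using fin[of n] sub[of n] tail[of ?H] positive_op_nonneg[OF A] Bessel_inequality[OF ons, of ?H y]
      by (intro mult_mono) (auto intro!: sum_nonneg)
    finally show ?thesis using positive_op_nonneg[OF A] by (simp add: mult.commute)
  qed
  moreover have "(\<lambda>n. blinfun_apply A (?p n) \<bullet> ?p n) \<longlonglongrightarrow> blinfun_apply A y \<bullet> y"
    by (intro tendsto_intros lim)
  ultimately show ?thesis
    by (intro LIMSEQ_le_const2) auto
qed

text \<open>
  Split a unit vector into its expansion over the finite set \<open>F\<close> and the rest.  On the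
  first part the forms of \<open>A\<close> and \<open>B\<close> differ by at most the sum of the entries
  of \<open>A - B\<close>, the coefficients being at most 1; on the second part the form of
  \<open>A\<close> is at most its trace outside \<open>F\<close>.
\<close>

lemma positive_op_norm_compare:
  assumes E: "orthonormal_basis ip E" and A: "positive_op A" and B: "positive_op B"
    and F: "finite F" "F \<subseteq> E"
    and tail: "\<And>G. finite G \<Longrightarrow> G \<subseteq> E - F \<Longrightarrow> (\<Sum>e\<in>G. blinfun_apply A e \<bullet> e) \<le> T"
  shows "sqrt (norm A)
    \<le> sqrt (norm B + (\<Sum>e\<in>F. \<Sum>f\<in>F. cmod (ip (blinfun_apply (A - B) e) f))) + sqrt T"
proof -
  have ons: "orthonormal_set ip E" using E by (simp add: orthonormal_basis_def)
  have T0: "0 \<le> T" using tail[of "{}"] by simp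
  define d where "d = (\<Sum>e\<in>F. \<Sum>f\<in>F. cmod (ip (blinfun_apply (A - B) e) f))"
  have d0: "0 \<le> d" unfolding d_def by (intro sum_nonneg) auto
  have "norm A \<le> (sqrt (norm B + d) + sqrt T)\<^sup>2"
  proof (rule positive_op_norm_le[OF A])
    fix x :: 'a assume x: "norm x \<le> 1"
    let ?p = "partial_expansion F x"
    have coeff: "cmod (ip x e) \<le> 1" if "e \<in> F" for e
    proof -
      have "(cmod (ip x e))\<^sup>2 \<le> (norm x)\<^sup>2"
        using Bessel_inequality[OF ons, of "{e}" x] that F by auto
      then have "cmod (ip x e) \<le> norm x" by (rule power2_le_imp_le) simp
      then show ?thesis using x by simp
    qed
    have "norm ?p \<le> 1"
    proof (rule power2_le_imp_le)
      show "(norm ?p)\<^sup>2 \<le> 1\<^sup>2"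
        using Bessel_inequality[OF ons F, of x] norm_partial_expansion[OF ons F, of x] x
          power_mono[OF x, of 2] by simp
    qed simp
    have "selfadjoint_op ip (A - B)"
      using A B by (intro selfadjoint_op_diff positive_op_selfadjoint)
    then have "ip (blinfun_apply (A - B) ?p) ?p
        = (\<Sum>e\<in>F. \<Sum>f\<in>F. ip x e * (cnj (ip x f) * ip (blinfun_apply (A - B) e) f))"
      unfolding partial_expansion_def
      by (simp add: blinfun.sum_right selfadjoint_op_scale ip_in_scalars ip_sum_left ip_sum_right
          ip_scale_left ip_scale_right sum_distrib_left)
        (subst sum.swap, simp add: mult_ac)
    also have "cmod \<dots> \<le> (\<Sum>e\<in>F. \<Sum>f\<in>F. cmod (ip (blinfun_apply (A - B) e) f))"
    proof (intro sum_norm_le)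
      fix e f assume "e \<in> F" "f \<in> F"
      then have "cmod (ip x e) * cmod (ip x f) \<le> 1 * 1"
        by (intro mult_mono coeff) auto
      then have "(cmod (ip x e) * cmod (ip x f)) * cmod (ip (blinfun_apply (A - B) e) f)
          \<le> 1 * cmod (ip (blinfun_apply (A - B) e) f)"
        by (intro mult_right_mono) auto
      then show "cmod (ip x e * (cnj (ip x f) * ip (blinfun_apply (A - B) e) f))
          \<le> cmod (ip (blinfun_apply (A - B) e) f)"
        by (simp add: norm_mult mult.assoc)
    qed
    finally have "(blinfun_apply (A - B) ?p) \<bullet> ?p \<le> d"
      unfolding d_def using complex_Re_le_cmod[of "ip (blinfun_apply (A - B) ?p) ?p"]
      by (simp add: Re_ip)
    moreover have "blinfun_apply B ?p \<bullet> ?p \<le> norm B * 1"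
      using \<open>norm ?p \<le> 1\<close> 
      by (intro quadratic_form_le_norm[THEN order_trans] mult_left_mono) (auto simp: power_le_one)
    ultimately have head: "blinfun_apply A ?p \<bullet> ?p \<le> norm B + d"
      by (simp add: blinfun.bilinear_simps inner_diff_left)
    have "blinfun_apply A (x - ?p) \<bullet> (x - ?p) \<le> T * (norm (x - ?p))\<^sup>2"
      using E A tail by (rule positive_op_tail)
        (use F in \<open>auto simp: ip_diff_left ip_partial_expansion[OF ons F]\<close>)
    also have "\<dots> \<le> T * 1"
      using norm_minus_partial_expansion_le[OF ons F, of x] x T0
      by (intro mult_left_mono power_le_one) auto
    finally have tl: "blinfun_apply A (x - ?p) \<bullet> (x - ?p) \<le> T" by simp
    have "sqrt (blinfun_apply A x \<bullet> x) \<le> sqrt (norm B + d) + sqrt T"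
      using positive_op_seminorm_triangle[OF A, of ?p "x - ?p"] real_sqrt_le_mono[OF head]
        real_sqrt_le_mono[OF tl] unfolding add_diff_cancel_left' add_diff_eq by linarith
    then have "(sqrt (blinfun_apply A x \<bullet> x))\<^sup>2 \<le> (sqrt (norm B + d) + sqrt T)\<^sup>2"
      using positive_op_nonneg[OF A] by (intro power_mono) auto
    then show "blinfun_apply A x \<bullet> x \<le> (sqrt (norm B + d) + sqrt T)\<^sup>2"
      using positive_op_nonneg[OF A] by simp
  qed
  then have "sqrt (norm A) \<le> sqrt (norm B + d) + sqrt T"
    using d0 T0 by (intro real_le_lsqrt) auto
  then show ?thesis unfolding d_def .
qed

end


section \<open>The trace\<close>

lemma infsum_ennreal_eq_nn_integral:
  fixes f :: "'b \<Rightarrow> ennreal"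
  assumes "countable A"
  shows "infsum f A = (\<integral>\<^sup>+x. f x \<partial>count_space A)"
proof (cases "finite A")
  case False
  note bij = bij_betw_from_nat_into[OF assms False]
  have "((\<lambda>n. f (from_nat_into A n)) has_sum infsum f A) UNIV"
    using has_sum_infsum[OF nonneg_summable_on_complete[of UNIV "\<lambda>n. f (from_nat_into A n)"]]
      infsum_reindex_bij_betw[OF bij, of f] by simp
  then have "infsum f A = (\<Sum>n. f (from_nat_into A n))"
    using has_sum_imp_sums sums_unique by blast
  then show ?thesis
    using nn_integral_bij_count_space[OF bij, of f] by (simp add: nn_integral_count_space_nat)
qed (simp add: nn_integral_count_space_finite)

context separable_hilbert_space
begin

definition trace_basis :: "'a set" where
  "trace_basis = (SOME E. orthonormal_basis ip E)"

lemma trace_basis: "orthonormal_basis ip trace_basis"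
  unfolding trace_basis_def using orthonormal_basis_exists by (rule someI_ex)

lemma countable_trace_basis: "countable trace_basis"
  using trace_basis orthonormal_set_countable by (auto simp: orthonormal_basis_def)

lemma ext_trace_eq_nn_integral:
  "ext_trace ip A = (\<integral>\<^sup>+e. ennreal (blinfun_apply A e \<bullet> e) \<partial>count_space trace_basis)"
  unfolding ext_trace_def trace_basis_def[symmetric] Re_ip
  by (rule infsum_ennreal_eq_nn_integral[OF countable_trace_basis])

lemma ext_trace_sum:
  assumes "\<And>i. i \<in> I \<Longrightarrow> positive_op (A i)"
  shows "ext_trace ip (\<Sum>i\<in>I. A i) = (\<Sum>i\<in>I. ext_trace ip (A i))"
proof -
  have "ext_trace ip (\<Sum>i\<in>I. A i)
      = (\<integral>\<^sup>+e. (\<Sum>i\<in>I. ennreal (blinfun_apply (A i) e \<bullet> e)) \<partial>count_space trace_basis)"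
    unfolding ext_trace_eq_nn_integral
    using assms by (intro nn_integral_cong)
      (simp add: blinfun.sum_left inner_sum_left positive_op_nonneg sum_ennreal)
  then show ?thesis
    by (simp add: nn_integral_sum ext_trace_eq_nn_integral)
qed

lemma ext_trace_scaleR:
  assumes "0 \<le> r"
  shows "ext_trace ip (r *\<^sub>R A) = ennreal r * ext_trace ip A"
  using assms by (simp add: ext_trace_eq_nn_integral blinfun.bilinear_simps ennreal_mult' nn_integral_cmult)

lemma ext_trace_mono:
  assumes "\<And>e. blinfun_apply A e \<bullet> e \<le> blinfun_apply B e \<bullet> e"
  shows "ext_trace ip A \<le> ext_trace ip B"
  unfolding ext_trace_eq_nn_integral by (intro nn_integral_mono ennreal_leI assms)

lemma op_tr_scaleR_sum:
  assumes "\<And>i. i \<in> I \<Longrightarrow> positive_op (A i)" "\<And>i. i \<in> I \<Longrightarrow> ext_trace ip (A i) < \<infinity>" "0 \<le> r"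
  shows "op_tr ip (r *\<^sub>R (\<Sum>i\<in>I. A i)) = r * (\<Sum>i\<in>I. op_tr ip (A i))"
    and "ext_trace ip (r *\<^sub>R (\<Sum>i\<in>I. A i)) < \<infinity>"
proof -
  show "op_tr ip (r *\<^sub>R (\<Sum>i\<in>I. A i)) = r * (\<Sum>i\<in>I. op_tr ip (A i))"
    using assms unfolding op_tr_def
    by (simp add: ext_trace_scaleR ext_trace_sum enn2real_mult enn2real_sum)
  show "ext_trace ip (r *\<^sub>R (\<Sum>i\<in>I. A i)) < \<infinity>"
    using assms ext_trace_sum[of "{}" A]
    by (cases "finite I") (simp_all add: ext_trace_scaleR ext_trace_sum ennreal_mult_less_top)
qed

lemma op_tr_le:
  assumes "ext_trace ip A \<le> ennreal b" "0 \<le> b"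
  shows "op_tr ip A \<le> b"
  unfolding op_tr_def using assms by (metis enn2real_ennreal enn2real_mono ennreal_less_top)

lemma op_tr_nonneg: "0 \<le> op_tr ip A"
  by (simp add: op_tr_def)

context
  fixes A :: "'a \<Rightarrow>\<^sub>L 'a"
  assumes A: "positive_op A" and finite_trace: "ext_trace ip A < \<infinity>"
begin

lemma ennreal_op_tr_eq_SUP:
  "ennreal (op_tr ip A)
    = (SUP F\<in>{F. finite F \<and> F \<subseteq> trace_basis}. ennreal (\<Sum>e\<in>F. blinfun_apply A e \<bullet> e))"
proof -
  have "ennreal (op_tr ip A) = ext_trace ip A"
    using finite_trace by (simp add: op_tr_def)
  then show ?thesis
    using positive_op_nonneg[OF A]
    by (simp add: ext_trace_def trace_basis_def[symmetric] Re_ip nonneg_infsum_complete sum_ennreal)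
qed

lemma sum_diagonal_le_op_tr:
  assumes "finite F" "F \<subseteq> trace_basis"
  shows "(\<Sum>e\<in>F. blinfun_apply A e \<bullet> e) \<le> op_tr ip A"
proof -
  have "ennreal (\<Sum>e\<in>F. blinfun_apply A e \<bullet> e) \<le> ennreal (op_tr ip A)"
    unfolding ennreal_op_tr_eq_SUP using assms by (intro SUP_upper) auto
  then show ?thesis by (simp add: op_tr_nonneg)
qed

lemma sum_diagonal_outside_le:
  assumes "finite F" "F \<subseteq> trace_basis" "finite G" "G \<subseteq> trace_basis - F"
  shows "(\<Sum>e\<in>G. blinfun_apply A e \<bullet> e) \<le> op_tr ip A - (\<Sum>e\<in>F. blinfun_apply A e \<bullet> e)"
proof -
  have "(\<Sum>e\<in>F \<union> G. blinfun_apply A e \<bullet> e) \<le> op_tr ip A"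
    using assms by (intro sum_diagonal_le_op_tr) auto
  moreover have "(\<Sum>e\<in>F \<union> G. blinfun_apply A e \<bullet> e)
      = (\<Sum>e\<in>F. blinfun_apply A e \<bullet> e) + (\<Sum>e\<in>G. blinfun_apply A e \<bullet> e)"
    using assms by (intro sum.union_disjoint) auto
  ultimately show ?thesis by simp
qed

lemma op_tr_approx:
  assumes "0 < \<epsilon>"
  obtains F where "finite F" "F \<subseteq> trace_basis" "op_tr ip A - (\<Sum>e\<in>F. blinfun_apply A e \<bullet> e) < \<epsilon>"
proof (cases "op_tr ip A < \<epsilon>")
  case True
  then show ?thesis using that[of "{}"] by simp
next
  case False
  then have "ennreal (op_tr ip A - \<epsilon>) < ennreal (op_tr ip A)"
    using assms by (intro ennreal_lessI) auto
  then obtain F where F: "finite F" "F \<subseteq> trace_basis"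
    and less: "ennreal (op_tr ip A - \<epsilon>) < ennreal (\<Sum>e\<in>F. blinfun_apply A e \<bullet> e)"
    unfolding ennreal_op_tr_eq_SUP less_SUP_iff by auto
  have "op_tr ip A - \<epsilon> < (\<Sum>e\<in>F. blinfun_apply A e \<bullet> e)"
    using less False by (simp add: ennreal_less_iff)
  then show ?thesis using that[OF F] by simp
qed

text \<open>With \<open>F\<close> empty, the tail estimate bounds the whole form by the trace.\<close>

lemma norm_le_op_tr: "norm A \<le> op_tr ip A"
proof (rule positive_op_norm_le[OF A])
  fix x :: 'a assume x: "norm x \<le> 1"
  have "blinfun_apply A x \<bullet> x \<le> op_tr ip A * (norm x)\<^sup>2"
    by (rule positive_op_tail[OF trace_basis A, of "{}"]) (auto intro: sum_diagonal_le_op_tr)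
  also have "\<dots> \<le> op_tr ip A * 1"
    using x op_tr_nonneg by (intro mult_left_mono power_le_one) auto
  finally show "blinfun_apply A x \<bullet> x \<le> op_tr ip A" by simp
qed

end

text \<open>
  A finite set of basis vectors carries all but \<open>\<epsilon>\<close> of the trace of \<open>A\<close>;
  convergence of the traces and of the finitely many entries makes the same set carry all but about
  \<open>\<epsilon>\<close> of the trace of \<open>A' n\<close> for large \<open>n\<close>.  The norm comparison
  then applies in both directions.
\<close>

lemma norm_tendsto_if_entries_and_trace_tendsto:
  assumes A': "\<And>n. positive_op (A' n)" "\<And>n. ext_trace ip (A' n) < \<infinity>"
    and A: "positive_op A" "ext_trace ip A < \<infinity>"
    and entries: "\<And>e f. e \<in> trace_basis \<Longrightarrow> f \<in> trace_basis \<Longrightarrow>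
      ((\<lambda>n. ip (blinfun_apply (A' n) e) f) \<longlongrightarrow> ip (blinfun_apply A e) f) \<F>"
    and trace: "((\<lambda>n. op_tr ip (A' n)) \<longlongrightarrow> op_tr ip A) \<F>"
  shows "((\<lambda>n. norm (A' n)) \<longlongrightarrow> norm A) \<F>"
proof -
  have "((\<lambda>n. sqrt (norm (A' n))) \<longlongrightarrow> sqrt (norm A)) \<F>"
  proof (rule tendstoI)
    fix \<eta> :: real assume \<eta>: "0 < \<eta>"
    define \<epsilon> where "\<epsilon> = \<eta> / 2"
    have \<epsilon>: "0 < \<epsilon>" using \<eta> by (simp add: \<epsilon>_def)
    obtain F where F: "finite F" "F \<subseteq> trace_basis"
      and tail: "op_tr ip A - (\<Sum>e\<in>F. blinfun_apply A e \<bullet> e) < \<epsilon>\<^sup>2"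
      using op_tr_approx[OF A, of "\<epsilon>\<^sup>2"] \<epsilon> by auto
    define T where "T B = op_tr ip B - (\<Sum>e\<in>F. blinfun_apply B e \<bullet> e)" for B
    define d where "d n = (\<Sum>e\<in>F. \<Sum>f\<in>F. cmod (ip (blinfun_apply (A' n - A) e) f))" for n
    have d_nonneg: "0 \<le> d n" for n unfolding d_def by (intro sum_nonneg) auto
    have "(d \<longlongrightarrow> (\<Sum>e\<in>F. \<Sum>f\<in>F. cmod (ip (blinfun_apply A e) f - ip (blinfun_apply A e) f))) \<F>"
      unfolding d_def blinfun.diff_left ip_diff_left
      using F by (intro tendsto_intros entries) auto
    then have d: "(d \<longlongrightarrow> 0) \<F>" by simp
    have diagonal: "((\<lambda>n. blinfun_apply (A' n) e \<bullet> e) \<longlongrightarrow> blinfun_apply A e \<bullet> e) \<F>"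
      if "e \<in> F" for e
      using tendsto_Re[OF entries[of e e]] that F by (auto simp: Re_ip)
    have T: "((\<lambda>n. T (A' n)) \<longlongrightarrow> T A) \<F>"
      unfolding T_def by (intro tendsto_intros trace diagonal)
    have upper: "sqrt (norm (A' n)) \<le> sqrt (norm A + d n) + sqrt (T (A' n))" for n
      unfolding d_def T_def
      by (intro positive_op_norm_compare[OF trace_basis A'(1) A(1) F]
          sum_diagonal_outside_le[OF A' F])
    have "d n = (\<Sum>e\<in>F. \<Sum>f\<in>F. cmod (ip (blinfun_apply (A - A' n) e) f))" for n
      unfolding d_def blinfun.diff_left ip_diff_left by (simp add: norm_minus_commute)
    then have lower: "sqrt (norm A) \<le> sqrt (norm (A' n) + d n) + sqrt (T A)" for n
      unfolding T_def
      by (simp only:) (intro positive_op_norm_compare[OF trace_basis A(1) A'(1) F]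
          sum_diagonal_outside_le[OF A F])
    have T_small: "sqrt (T A) < \<epsilon>"
      using tail \<epsilon> real_sqrt_less_mono[of "T A" "\<epsilon>\<^sup>2"] by (simp add: T_def)
    have "((\<lambda>n. sqrt (norm A + d n) + sqrt (T (A' n))) \<longlongrightarrow> sqrt (norm A + 0) + sqrt (T A)) \<F>"
      by (intro tendsto_intros d T)
    then have ev1: "\<forall>\<^sub>F n in \<F>. sqrt (norm A + d n) + sqrt (T (A' n)) < sqrt (norm A) + \<eta>"
      by (rule order_tendstoD) (use T_small \<epsilon> in \<open>simp add: \<epsilon>_def\<close>)
    have "((\<lambda>n. sqrt (d n)) \<longlongrightarrow> sqrt 0) \<F>" by (intro tendsto_intros d)
    then have ev2: "\<forall>\<^sub>F n in \<F>. sqrt (d n) < \<epsilon>"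
      by (rule order_tendstoD) (use \<epsilon> in simp)
    from ev1 ev2 show "\<forall>\<^sub>F n in \<F>. dist (sqrt (norm (A' n))) (sqrt (norm A)) < \<eta>"
    proof eventually_elim
      case (elim n)
      have "sqrt (norm (A' n) + d n) \<le> sqrt (norm (A' n)) + sqrt (d n)"
        using d_nonneg by (simp add: sqrt_add_le_add_sqrt)
      then show ?case
        using upper[of n] lower[of n] elim T_small unfolding dist_real_def \<epsilon>_def by linarith
    qed
  qed
  then have "((\<lambda>n. (sqrt (norm (A' n)))\<^sup>2) \<longlongrightarrow> (sqrt (norm A))\<^sup>2) \<F>"
    by (rule tendsto_power)
  then show ?thesis by simp
qed

end


section \<open>Bounded independent random variables\<close>

text \<open>
  Hoeffding's inequality bounds the probability that the average of \<open>n\<close> variables deviates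
  from \<open>m\<close> by \<open>\<epsilon>\<close> by a term of a geometric series, so the Borel-Cantelli lemma
  applies.
\<close>

lemma (in prob_space) strong_law_bounded:
  fixes Z :: "nat \<Rightarrow> 'a \<Rightarrow> real"
  assumes indep: "indep_vars (\<lambda>_. borel) Z {1..}"
    and bound: "\<And>i. i \<ge> 1 \<Longrightarrow> AE \<omega> in M. \<bar>Z i \<omega>\<bar> \<le> b"
    and mean: "\<And>i. i \<ge> 1 \<Longrightarrow> expectation (Z i) = m"
  shows "AE \<omega> in M. (\<lambda>n. (\<Sum>i = 1..n. Z i \<omega>) / real n) \<longlonglongrightarrow> m"
proof -
  \<comment> \<open>Hoeffding's inequality needs intervals of positive length, and \<open>b\<close> may be 0.\<close>
  define a where "a = max b 1"
  have a: "a > 0" "b \<le> a" by (auto simp: a_def)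
  have meas: "Z i \<in> borel_measurable M" if "i \<ge> 1" for i
    using indep that by (simp add: indep_vars_def)
  have sum_meas: "(\<lambda>\<omega>. \<Sum>i = 1..n. Z i \<omega>) \<in> borel_measurable M" for n
    by (intro borel_measurable_sum meas) auto
  have ev: "AE \<omega> in M. \<forall>\<^sub>F n in sequentially. \<bar>(\<Sum>i = 1..n. Z i \<omega>) - real n * m\<bar> < real n * \<epsilon>"
    if \<epsilon>: "\<epsilon> > 0" for \<epsilon> :: real
  proof -
    define A where "A n = {\<omega> \<in> space M. real n * \<epsilon> \<le> \<bar>(\<Sum>i = 1..n. Z i \<omega>) - real n * m\<bar>}" for n
    define r where "r = exp (- (\<epsilon>\<^sup>2 / (2 * a\<^sup>2)))"
    have A_meas: "A n \<in> sets M" for n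
      unfolding A_def using sum_meas[of n] by measurable
    have "prob (A n) \<le> 2 * r ^ n" for n
    proof (cases "n = 0")
      case True
      then show ?thesis using order_trans[OF prob_le_1[of "A n"], of 2] by simp
    next
      case False
      interpret Hoeffding_ineq M "{1..n}" Z "\<lambda>_. - a" "\<lambda>_. a" "real n * m"
      proof unfold_locales
        show "indep_vars (\<lambda>_. borel) Z {1..n}"
          using indep by (rule indep_vars_subset) auto
        show "AE x in M. Z i x \<in> {- a..a}" if "i \<in> {1..n}" for i
          using bound[of i] that a by (auto elim!: eventually_mono)
        show "real n * m \<equiv> \<Sum>i\<in>{1..n}. expectation (Z i)"
          using mean by (intro eq_reflection) simp
      qed auto
      have "(\<Sum>i\<in>{1..n}. (a - (- a))\<^sup>2) > 0"
        using False a by simp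
      then have "prob (A n) \<le> 2 * exp (- 2 * (real n * \<epsilon>)\<^sup>2 / (\<Sum>i\<in>{1..n}. (a - (- a))\<^sup>2))"
        unfolding A_def using \<epsilon> by (intro Hoeffding_ineq_abs_ge) auto
      also have "- 2 * (real n * \<epsilon>)\<^sup>2 / (\<Sum>i\<in>{1..n}. (a - (- a))\<^sup>2) = real n * - (\<epsilon>\<^sup>2 / (2 * a\<^sup>2))"
        using False a by (simp add: field_simps power2_eq_square)
      also have "exp \<dots> = r ^ n"
        unfolding r_def by (rule exp_of_nat_mult)
      finally show ?thesis .
    qed
    moreover have "summable (\<lambda>n. 2 * r ^ n)"
      using \<epsilon> a by (intro summable_mult summable_geometric) (simp add: r_def)
    ultimately have "summable (\<lambda>n. prob (A n))"
      by (intro summable_comparison_test[of "\<lambda>n. prob (A n)" "\<lambda>n. 2 * r ^ n"]) auto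
    then have "AE \<omega> in M. \<forall>\<^sub>F n in sequentially. \<omega> \<in> space M - A n"
      by (intro borel_cantelli_AE1 A_meas) (auto simp: less_top[symmetric])
    then show ?thesis
      by (elim eventually_mono) (auto simp: A_def not_le elim!: eventually_mono)
  qed
  have "AE \<omega> in M. \<forall>k. \<forall>\<^sub>F n in sequentially.
      \<bar>(\<Sum>i = 1..n. Z i \<omega>) - real n * m\<bar> < real n * (1 / real (Suc k))"
    unfolding AE_all_countable by (intro allI ev) simp
  then show ?thesis
  proof (rule eventually_mono)
    fix \<omega>
    assume *: "\<forall>k. \<forall>\<^sub>F n in sequentially.
      \<bar>(\<Sum>i = 1..n. Z i \<omega>) - real n * m\<bar> < real n * (1 / real (Suc k))"
    show "(\<lambda>n. (\<Sum>i = 1..n. Z i \<omega>) / real n) \<longlonglongrightarrow> m"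
    proof (rule tendstoI)
      fix e :: real assume "e > 0"
      then obtain k where k: "1 / real (Suc k) < e" using nat_approx_posE by blast
      have "\<forall>\<^sub>F n in sequentially.
          \<bar>(\<Sum>i = 1..n. Z i \<omega>) - real n * m\<bar> < real n * (1 / real (Suc k))"
        using * by blast
      with eventually_gt_at_top[of 0]
      show "\<forall>\<^sub>F n in sequentially. dist ((\<Sum>i = 1..n. Z i \<omega>) / real n) m < e"
      proof eventually_elim
        case (elim n)
        have "dist ((\<Sum>i = 1..n. Z i \<omega>) / real n) m = \<bar>(\<Sum>i = 1..n. Z i \<omega>) - real n * m\<bar> / real n"
          using elim(1) by (simp add: dist_real_def diff_divide_distrib[symmetric] divide_diff_eq_iff mult.commute)
        also have "\<dots> < 1 / real (Suc k)"
          using elim by (simp add: divide_less_eq mult.commute)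
        finally show ?case using k by simp
      qed
    qed
  qed
qed

lemma (in prob_space) indep_vars_consecutive_pairs:
  fixes X :: "nat \<Rightarrow> 'a \<Rightarrow> 'b" and f :: "'b \<times> 'b \<Rightarrow> 'c"
  assumes indep: "indep_vars (\<lambda>_. N) X {1..}" and f: "f \<in> measurable (N \<Otimes>\<^sub>M N) L"
  shows "indep_vars (\<lambda>_. L) (\<lambda>i \<omega>. f (X (2 * i - 1) \<omega>, X (2 * i) \<omega>)) {1..}"
proof -
  let ?K = "\<lambda>i::nat. {2 * i - 1, 2 * i}"
  have "disjoint_family_on ?K {1..}"
    by (auto simp: disjoint_family_on_def)
  then have "indep_vars (\<lambda>i. PiM (?K i) (\<lambda>_. N)) (\<lambda>i \<omega>. restrict (\<lambda>j. X j \<omega>) (?K i)) {1..}"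
    by (intro indep_vars_restrict[OF indep]) auto
  then have "indep_vars (\<lambda>_. L)
      (\<lambda>i \<omega>. (\<lambda>g. f (g (2 * i - 1), g (2 * i))) (restrict (\<lambda>j. X j \<omega>) (?K i))) {1..}"
    by (rule indep_vars_compose2)
      (intro measurable_compose[OF measurable_Pair f] measurable_component_singleton; simp)
  then show ?thesis by simp
qed

lemma (in prob_space) integrable_norm_bounded:
  fixes Y :: "'a \<Rightarrow> 'b::{banach, second_countable_topology}"
  assumes "Y \<in> borel_measurable M" "AE \<omega> in M. norm (Y \<omega>) \<le> b"
  shows "integrable M Y"
  using assms by (rule integrable_const_bound[rotated])

text \<open>The joint distribution is a product measure, so Fubini's theorem applies.\<close>

lemma (in prob_space) expectation_inner_indep:
  fixes Y Z :: "'a \<Rightarrow> 'b::{real_inner, banach, second_countable_topology}"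
  assumes indep: "indep_var borel Y borel Z"
    and Y: "AE \<omega> in M. norm (Y \<omega>) \<le> a" and Z: "AE \<omega> in M. norm (Z \<omega>) \<le> b"
  shows "expectation (\<lambda>\<omega>. Y \<omega> \<bullet> Z \<omega>) = expectation Y \<bullet> expectation Z"
proof -
  have [measurable]: "Y \<in> borel_measurable M" "Z \<in> borel_measurable M"
    using indep by (auto dest: indep_var_rv1 indep_var_rv2)
  let ?\<nu>Y = "distr M borel Y" and ?\<nu>Z = "distr M borel Z"
  interpret Y: prob_space ?\<nu>Y by (rule prob_space_distr) measurable
  interpret Z: prob_space ?\<nu>Z by (rule prob_space_distr) measurable
  interpret YZ: pair_prob_space ?\<nu>Y ?\<nu>Z ..
  have joint: "?\<nu>Y \<Otimes>\<^sub>M ?\<nu>Z = distr M (borel \<Otimes>\<^sub>M borel) (\<lambda>\<omega>. (Y \<omega>, Z \<omega>))"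
    using indep by (simp add: indep_var_distribution_eq)
  have int_Y: "integrable ?\<nu>Y (\<lambda>y. y)" and int_Z: "integrable ?\<nu>Z (\<lambda>z. z)"
    using integrable_norm_bounded[OF _ Y] integrable_norm_bounded[OF _ Z]
    by (auto simp: integrable_distr_eq)
  have "AE \<omega> in M. norm (Y \<omega> \<bullet> Z \<omega>) \<le> a * b"
    using Y Z
  proof eventually_elim
    case (elim \<omega>)
    have "norm (Y \<omega>) * norm (Z \<omega>) \<le> a * b"
      using elim order_trans[OF norm_ge_zero elim(1)] by (intro mult_mono) auto
    then show ?case
      using Cauchy_Schwarz_ineq2[of "Y \<omega>" "Z \<omega>"] by simp
  qed
  then have "integrable M (\<lambda>\<omega>. Y \<omega> \<bullet> Z \<omega>)"
    by (intro integrable_norm_bounded) auto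
  then have int: "integrable (?\<nu>Y \<Otimes>\<^sub>M ?\<nu>Z) (\<lambda>(y, z). y \<bullet> z)"
    unfolding joint by (subst integrable_distr_eq) auto
  have "expectation (\<lambda>\<omega>. Y \<omega> \<bullet> Z \<omega>) = (\<integral>p. (case p of (y, z) \<Rightarrow> y \<bullet> z) \<partial>(?\<nu>Y \<Otimes>\<^sub>M ?\<nu>Z))"
    unfolding joint by (subst integral_distr) auto
  also have "\<dots> = (\<integral>y. (\<integral>z. y \<bullet> z \<partial>?\<nu>Z) \<partial>?\<nu>Y)"
    using YZ.integral_fst'[OF int] by simp
  also have "\<dots> = (\<integral>y. y \<partial>?\<nu>Y) \<bullet> (\<integral>z. z \<partial>?\<nu>Z)"
    using int_Y int_Z by simp
  also have "\<dots> = expectation Y \<bullet> expectation Z"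
    by (simp add: integral_distr)
  finally show ?thesis .
qed


section \<open>Expectations of random operators\<close>

lemma borel_measurable_blinfun_apply:
  assumes "Y \<in> borel_measurable M"
  shows "(\<lambda>\<omega>. blinfun_apply (Y \<omega>) u) \<in> borel_measurable M"
  using assms by (rule measurable_compose) (intro borel_measurable_continuous_onI continuous_intros)

context prob_space
begin

context
  fixes Y :: "'a \<Rightarrow> 'b::{banach, second_countable_topology} \<Rightarrow>\<^sub>L 'b" and b :: real
  assumes Y: "Y \<in> borel_measurable M" and bound: "AE \<omega> in M. norm (Y \<omega>) \<le> b"
begin

lemma AE_norm_random_operator_apply: "AE \<omega> in M. norm (blinfun_apply (Y \<omega>) u) \<le> b * norm u"
  using bound
proof eventually_elim
  case (elim \<omega>)
  then show ?case
    using norm_blinfun[of "Y \<omega>" u] mult_right_mono[OF elim, of "norm u"] by simp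
qed

lemma integrable_random_operator_apply: "integrable M (\<lambda>\<omega>. blinfun_apply (Y \<omega>) u)"
  using borel_measurable_blinfun_apply[OF Y] AE_norm_random_operator_apply
  by (rule integrable_norm_bounded)

text \<open>
  The term \<open>Blinfun\<close> in the definition of the expectation is meaningful only for a bounded
  linear map; the almost sure bound on \<open>Y\<close> supplies this.
\<close>

lemma blinfun_apply_op_expectation:
  "blinfun_apply (op_expectation M Y) u = expectation (\<lambda>\<omega>. blinfun_apply (Y \<omega>) u)"
proof -
  have "bounded_linear (\<lambda>u. expectation (\<lambda>\<omega>. blinfun_apply (Y \<omega>) u))"
  proof (rule bounded_linear_intro[where K = b])
    fix u
    have "norm (expectation (\<lambda>\<omega>. blinfun_apply (Y \<omega>) u)) \<le> expectation (\<lambda>\<omega>. norm (blinfun_apply (Y \<omega>) u))"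
      by (rule integral_norm_bound)
    also have "\<dots> \<le> expectation (\<lambda>_. b * norm u)"
      using AE_norm_random_operator_apply
      by (intro integral_mono_AE integrable_norm integrable_random_operator_apply) auto
    finally show "norm (expectation (\<lambda>\<omega>. blinfun_apply (Y \<omega>) u)) \<le> norm u * b"
      by (simp add: prob_space mult.commute)
  qed (auto simp: blinfun.bilinear_simps integrable_random_operator_apply)
  then show ?thesis
    unfolding op_expectation_def by (simp add: bounded_linear_Blinfun_apply)
qed

end

end

lemma (in separable_hilbert_space) selfadjoint_op_expectation:
  assumes M: "prob_space M" and Y: "Y \<in> borel_measurable M" "AE \<omega> in M. norm (Y \<omega>) \<le> b"
    and sa: "\<And>\<omega>. \<omega> \<in> space M \<Longrightarrow> selfadjoint_op ip (Y \<omega>)"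
  shows "selfadjoint_op ip (op_expectation M Y)"
proof -
  interpret prob_space M by (rule M)
  note int = integrable_random_operator_apply[OF Y]
  have *: "ip (blinfun_apply (op_expectation M Y) x) y = (\<integral>\<omega>. ip (blinfun_apply (Y \<omega>) x) y \<partial>M)" for x y
    unfolding blinfun_apply_op_expectation[OF Y]
    using integral_bounded_linear[OF bounded_linear_ip_left int] by simp
  have "ip (blinfun_apply (op_expectation M Y) x) y = ip x (blinfun_apply (op_expectation M Y) y)" for x y
  proof -
    have "ip (blinfun_apply (op_expectation M Y) x) y = (\<integral>\<omega>. cnj (ip (blinfun_apply (Y \<omega>) y) x) \<partial>M)"
      unfolding * using sa ip_commute by (intro Bochner_Integration.integral_cong refl) (metis selfadjoint_op_def)
    also have "\<dots> = cnj (ip (blinfun_apply (op_expectation M Y) y) x)"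
      unfolding * by simp
    finally show ?thesis using ip_commute by metis
  qed
  then show ?thesis by (simp add: selfadjoint_op_def)
qed


section \<open>Paired squares and their deterministic bounds\<close>

lemma norm_op_sq_le: "norm (op_sq A) \<le> (norm A)\<^sup>2"
  unfolding op_sq_def by (metis norm_blinfun_compose power2_eq_square)

context separable_hilbert_space
begin

lemma paired_inner:
  assumes "selfadjoint_op ip (x (2 * i - 1))" "selfadjoint_op ip (x (2 * i))"
  shows "blinfun_apply (paired x i) u \<bullet> v
    = (1/2) * ((blinfun_apply (x (2 * i - 1)) u - blinfun_apply (x (2 * i)) u) \<bullet>
               (blinfun_apply (x (2 * i - 1)) v - blinfun_apply (x (2 * i)) v))"
  unfolding paired_def using op_sq_inner[OF selfadjoint_op_diff[OF assms]]
  by (simp add: blinfun.bilinear_simps)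

lemma positive_op_paired:
  assumes "selfadjoint_op ip (x (2 * i - 1))" "selfadjoint_op ip (x (2 * i))"
  shows "positive_op (paired x i)"
  unfolding paired_def using assms by (intro positive_op_scaleR positive_op_sq selfadjoint_op_diff) auto

lemma norm_paired_le:
  assumes "norm (x (2 * i - 1)) \<le> c" "norm (x (2 * i)) \<le> c"
  shows "norm (paired x i) \<le> 2 * c\<^sup>2"
proof -
  have "norm (x (2 * i - 1) - x (2 * i)) \<le> 2 * c"
    using norm_triangle_ineq4[of "x (2 * i - 1)" "x (2 * i)"] assms by simp
  then have "norm (op_sq (x (2 * i - 1) - x (2 * i))) \<le> (2 * c)\<^sup>2"
    by (intro order_trans[OF norm_op_sq_le] power_mono) auto
  then show ?thesis by (simp add: paired_def power_mult_distrib)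
qed

text \<open>
  Pointwise \<open>\<parallel>a - b\<parallel>\<^sup>2 / 2 \<le> \<parallel>a\<parallel>\<^sup>2 + \<parallel>b\<parallel>\<^sup>2\<close>, and the trace of a square is
  a sum of squared norms.
\<close>

lemma ext_trace_paired_le:
  assumes sa: "selfadjoint_op ip (x (2 * i - 1))" "selfadjoint_op ip (x (2 * i))"
    and i: "1 \<le> i" and t: "0 \<le> t"
    and tr: "ext_trace ip (op_sq (x (2 * i - 1))) \<le> ennreal t" "ext_trace ip (op_sq (x (2 * i))) \<le> ennreal t"
  shows "ext_trace ip (paired x i) \<le> ennreal (2 * t)"
proof -
  have "ext_trace ip (paired x i) \<le> ext_trace ip (op_sq (x (2 * i - 1)) + op_sq (x (2 * i)))"
  proof (rule ext_trace_mono)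
    fix e
    let ?a = "blinfun_apply (x (2 * i - 1)) e" and ?b = "blinfun_apply (x (2 * i)) e"
    have "0 \<le> (?a + ?b) \<bullet> (?a + ?b)" by simp
    then show "blinfun_apply (paired x i) e \<bullet> e
        \<le> blinfun_apply (op_sq (x (2 * i - 1)) + op_sq (x (2 * i))) e \<bullet> e"
      unfolding paired_inner[of x, OF sa]
      unfolding blinfun.add_left inner_add_left op_sq_inner[OF sa(1)] op_sq_inner[OF sa(2)]
      by (simp add: inner_diff inner_add inner_commute[of ?b ?a])
  qed
  also have "\<dots> = ext_trace ip (\<Sum>j\<in>{2 * i - 1, 2 * i}. op_sq (x j))"
    using i by simp
  also have "\<dots> = ext_trace ip (op_sq (x (2 * i - 1))) + ext_trace ip (op_sq (x (2 * i)))"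
    using i sa by (subst ext_trace_sum) (auto intro: positive_op_sq)
  also have "\<dots> \<le> ennreal t + ennreal t"
    using tr by (rule add_mono)
  finally show ?thesis
    using t by (simp flip: ennreal_plus)
qed

text \<open>
  Cauchy-Schwarz for the form of \<open>P\<close>, applied to \<open>e\<close> and \<open>P e\<close>, gives
  \<open>\<parallel>P e\<parallel>\<^sup>2 \<le> \<parallel>P\<parallel> (P e \<bullet> e)\<close>.
\<close>

lemma ext_trace_op_sq_le:
  assumes "positive_op P"
  shows "ext_trace ip (op_sq P) \<le> ennreal (norm P) * ext_trace ip P"
proof -
  have "ext_trace ip (op_sq P) \<le> ext_trace ip (norm P *\<^sub>R P)"
  proof (rule ext_trace_mono)
    fix e
    let ?y = "blinfun_apply P e"
    have "(norm ?y)\<^sup>2 = \<bar>blinfun_apply P e \<bullet> ?y\<bar>" by (simp add: power2_norm_eq_inner)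
    also have "\<dots> \<le> sqrt (?y \<bullet> e) * sqrt (blinfun_apply P ?y \<bullet> ?y)"
      by (rule positive_op_Cauchy_Schwarz[OF assms])
    also have "\<dots> \<le> sqrt (?y \<bullet> e) * sqrt (norm P * (norm ?y)\<^sup>2)"
      using positive_op_nonneg[OF assms, of e] quadratic_form_le_norm[of P ?y]
      by (intro mult_left_mono) auto
    also have "\<dots> = sqrt (norm P * (?y \<bullet> e)) * norm ?y"
      by (simp add: real_sqrt_mult)
    finally have "norm ?y * norm ?y \<le> sqrt (norm P * (?y \<bullet> e)) * norm ?y"
      by (simp add: power2_eq_square)
    then have "norm ?y \<le> sqrt (norm P * (?y \<bullet> e))"
      using positive_op_nonneg[OF assms, of e] by (cases "?y = 0") auto
    then have "(norm ?y)\<^sup>2 \<le> (sqrt (norm P * (?y \<bullet> e)))\<^sup>2"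
      by (intro power_mono) auto
    then have "(norm ?y)\<^sup>2 \<le> norm P * (?y \<bullet> e)"
      using positive_op_nonneg[OF assms, of e] by simp
    then show "blinfun_apply (op_sq P) e \<bullet> e \<le> blinfun_apply (norm P *\<^sub>R P) e \<bullet> e"
      using op_sq_inner[OF positive_op_selfadjoint[OF assms], of e e]
      by (simp add: blinfun.bilinear_simps power2_norm_eq_inner)
  qed
  then show ?thesis by (simp add: ext_trace_scaleR)
qed

end


section \<open>Almost sure convergence of the paired sample variance\<close>

locale random_operator_sequence = separable_hilbert_space K scale ip + prob_space M
  for K :: "complex set"
    and scale :: "complex \<Rightarrow> 'a \<Rightarrow> 'a::{real_inner, banach, second_countable_topology}"
    and ip :: "'a \<Rightarrow> 'a \<Rightarrow> complex"
    and M :: "'w measure" +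
  fixes X :: "nat \<Rightarrow> 'w \<Rightarrow> 'a \<Rightarrow>\<^sub>L 'a" and \<mu> S :: "'a \<Rightarrow>\<^sub>L 'a" and c B :: real
  assumes indep: "indep_vars (\<lambda>_. borel) X {1..}"
    and selfadjoint: "\<And>i \<omega>. i \<ge> 1 \<Longrightarrow> \<omega> \<in> space M \<Longrightarrow> selfadjoint_op ip (X i \<omega>)"
    and B_pos: "B > 0"
    and norm_bound: "\<And>i. i \<ge> 1 \<Longrightarrow> AE \<omega> in M. norm (X i \<omega>) \<le> c"
    and trace_bound: "\<And>i. i \<ge> 1 \<Longrightarrow> AE \<omega> in M. ext_trace ip (op_sq (X i \<omega>)) \<le> ennreal B"
    and mean: "\<And>i. i \<ge> 1 \<Longrightarrow> op_expectation M (X i) = \<mu>"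
    and var: "\<And>i. i \<ge> 1 \<Longrightarrow> op_variance M (X i) = S"
begin

lemma X_measurable: "i \<ge> 1 \<Longrightarrow> X i \<in> borel_measurable M"
  using indep by (simp add: indep_vars_def)

lemma selfadjoint_mean: "selfadjoint_op ip \<mu>"
proof -
  have "selfadjoint_op ip (op_expectation M (X 1))"
    using selfadjoint by (intro selfadjoint_op_expectation[OF prob_space_axioms X_measurable norm_bound]) auto
  then show ?thesis using mean[OF order_refl] by simp
qed

lemma expectation_X_apply:
  assumes "i \<ge> 1"
  shows "expectation (\<lambda>\<omega>. blinfun_apply (X i \<omega>) u) = blinfun_apply \<mu> u"
  using blinfun_apply_op_expectation[OF X_measurable[OF assms] norm_bound[OF assms], of u] mean assms by simp

lemma AE_norm_centered:
  assumes "i \<ge> 1"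
  shows "AE \<omega> in M. norm (X i \<omega> - \<mu>) \<le> c + norm \<mu>"
  using norm_bound[OF assms]
proof eventually_elim
  case (elim \<omega>)
  then show ?case using norm_triangle_ineq4[of "X i \<omega>" \<mu>] by simp
qed

lemma centered_sq_measurable: "i \<ge> 1 \<Longrightarrow> (\<lambda>\<omega>. op_sq (X i \<omega> - \<mu>)) \<in> borel_measurable M"
  unfolding op_sq_def
  by (rule measurable_compose[OF X_measurable borel_measurable_continuous_onI], assumption)
    (intro continuous_intros bounded_bilinear.continuous_on[OF bounded_bilinear_blinfun_compose])

lemma AE_norm_centered_sq:
  assumes "i \<ge> 1"
  shows "AE \<omega> in M. norm (op_sq (X i \<omega> - \<mu>)) \<le> (c + norm \<mu>)\<^sup>2"
  using AE_norm_centered[OF assms]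
  by eventually_elim (intro order_trans[OF norm_op_sq_le] power_mono, auto)

lemma S_eq:
  assumes "i \<ge> 1"
  shows "S = op_expectation M (\<lambda>\<omega>. op_sq (X i \<omega> - \<mu>))"
  using var[OF assms] mean[OF assms] by (simp add: op_variance_def)

lemma S_inner:
  assumes "i \<ge> 1"
  shows "blinfun_apply S u \<bullet> v = expectation (\<lambda>\<omega>.
    (blinfun_apply (X i \<omega>) u - blinfun_apply \<mu> u) \<bullet> (blinfun_apply (X i \<omega>) v - blinfun_apply \<mu> v))"
proof -
  note sq = centered_sq_measurable[OF assms] AE_norm_centered_sq[OF assms]
  have "blinfun_apply S u \<bullet> v = expectation (\<lambda>\<omega>. blinfun_apply (op_sq (X i \<omega> - \<mu>)) u) \<bullet> v"
    using S_eq[OF assms] blinfun_apply_op_expectation[OF sq] by simp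
  also have "\<dots> = expectation (\<lambda>\<omega>. blinfun_apply (op_sq (X i \<omega> - \<mu>)) u \<bullet> v)"
    using integrable_random_operator_apply[OF sq] by simp
  also have "\<dots> = expectation (\<lambda>\<omega>.
    (blinfun_apply (X i \<omega>) u - blinfun_apply \<mu> u) \<bullet> (blinfun_apply (X i \<omega>) v - blinfun_apply \<mu> v))"
    using op_sq_inner[OF selfadjoint_op_diff[OF selfadjoint[OF assms] selfadjoint_mean]]
    by (intro Bochner_Integration.integral_cong refl) (simp add: blinfun.bilinear_simps)
  finally show ?thesis .
qed

lemma positive_op_S: "positive_op S"
  unfolding positive_op_def
proof (intro conjI allI)
  show "selfadjoint_op ip S"
    by (subst S_eq[OF order_refl], rule selfadjoint_op_expectation[OF prob_space_axioms
        centered_sq_measurable[OF order_refl] AE_norm_centered_sq[OF order_refl]])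
      (intro positive_op_selfadjoint positive_op_sq selfadjoint_op_diff selfadjoint selfadjoint_mean; simp)
  show "0 \<le> blinfun_apply S x \<bullet> x" for x
    by (subst S_inner[of 1]) (auto intro!: integral_nonneg)
qed

abbreviation Y :: "nat \<Rightarrow> 'w \<Rightarrow> 'a \<Rightarrow>\<^sub>L 'a" where
  "Y i \<omega> \<equiv> paired (\<lambda>j. X j \<omega>) i"

lemma Y_inner:
  assumes "i \<ge> 1" "\<omega> \<in> space M"
  shows "blinfun_apply (Y i \<omega>) u \<bullet> v
    = (1/2) * ((blinfun_apply (X (2 * i - 1) \<omega>) u - blinfun_apply (X (2 * i) \<omega>) u) \<bullet>
               (blinfun_apply (X (2 * i - 1) \<omega>) v - blinfun_apply (X (2 * i) \<omega>) v))"
  using assms by (intro paired_inner selfadjoint) auto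

lemma AE_norm_Y:
  assumes "i \<ge> 1"
  shows "AE \<omega> in M. norm (Y i \<omega>) \<le> 2 * c\<^sup>2"
proof -
  have "2 * i - 1 \<ge> 1" "2 * i \<ge> 1" using assms by auto
  from norm_bound[OF this(1)] norm_bound[OF this(2)] show ?thesis
    by eventually_elim (rule norm_paired_le)
qed

lemma AE_ext_trace_Y:
  assumes "i \<ge> 1"
  shows "AE \<omega> in M. ext_trace ip (Y i \<omega>) \<le> ennreal (2 * B)"
proof -
  have i: "2 * i - 1 \<ge> 1" "2 * i \<ge> 1" using assms by auto
  show ?thesis
    using trace_bound[OF i(1)] trace_bound[OF i(2)] AE_space
    by eventually_elim
      (use ext_trace_paired_le[OF selfadjoint[OF i(1)] selfadjoint[OF i(2)] assms] B_pos in simp)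
qed

text \<open>
  Centering the two operators does not change their difference.  In the expanded product of the
  centered differences, each of the two terms that involve a single index contributes
  \<open>S u \<bullet> v\<close>, and the cross terms vanish by independence.
\<close>

lemma expectation_Y_inner:
  assumes i: "i \<ge> 1"
  shows "expectation (\<lambda>\<omega>. blinfun_apply (Y i \<omega>) u \<bullet> v) = blinfun_apply S u \<bullet> v"
proof -
  define W where "W j w \<omega> = blinfun_apply (X j \<omega>) w - blinfun_apply \<mu> w" for j w \<omega>
  let ?j = "2 * i - 1" and ?k = "2 * i"
  have jk: "?j \<ge> 1" "?k \<ge> 1" using i by auto
  have W_meas: "W j w \<in> borel_measurable M" if "j \<ge> 1" for j w
    unfolding W_def using borel_measurable_blinfun_apply[OF X_measurable[OF that]] by measurable
  have W_bound: "AE \<omega> in M. norm (W j w \<omega>) \<le> (c + norm \<mu>) * norm w" if "j \<ge> 1" for j w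
    using AE_norm_centered[OF that]
  proof eventually_elim
    case (elim \<omega>)
    have "norm (W j w \<omega>) \<le> norm (X j \<omega> - \<mu>) * norm w"
      unfolding W_def blinfun.diff_left[symmetric] by (rule norm_blinfun)
    then show ?case using mult_right_mono[OF elim, of "norm w"] by simp
  qed
  have W_mean: "expectation (W j w) = 0" if "j \<ge> 1" for j w
    unfolding W_def using expectation_X_apply[OF that]
      integrable_random_operator_apply[OF X_measurable[OF that] norm_bound[OF that]]
    by (simp add: prob_space)
  have W_int: "integrable M (\<lambda>\<omega>. W j w \<omega> \<bullet> W j' w' \<omega>)" if "j \<ge> 1" "j' \<ge> 1" for j w j' w'
  proof (rule integrable_norm_bounded)
    show "AE \<omega> in M. norm (W j w \<omega> \<bullet> W j' w' \<omega>) \<le> ((c + norm \<mu>) * norm w) * ((c + norm \<mu>) * norm w')"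
      using W_bound[OF that(1), of w] W_bound[OF that(2), of w']
    proof eventually_elim
      case (elim \<omega>)
      have "norm (W j w \<omega>) * norm (W j' w' \<omega>) \<le> ((c + norm \<mu>) * norm w) * ((c + norm \<mu>) * norm w')"
        using elim order_trans[OF norm_ge_zero elim(1)] by (intro mult_mono) auto
      then show ?case using Cauchy_Schwarz_ineq2[of "W j w \<omega>" "W j' w' \<omega>"] by simp
    qed
  qed (use W_meas that in measurable)
  have cross: "expectation (\<lambda>\<omega>. W ?j w \<omega> \<bullet> W ?k w' \<omega>) = 0" for w w'
  proof -
    have f: "(\<lambda>g. blinfun_apply (g l) u - blinfun_apply \<mu> u) \<in> borel_measurable (PiM {l} (\<lambda>_. borel))"
      for l :: nat and u
      by (intro borel_measurable_diff borel_measurable_blinfun_apply measurable_component_singleton) auto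
    have "indep_var borel ((\<lambda>g. blinfun_apply (g ?j) w - blinfun_apply \<mu> w) \<circ> (\<lambda>\<omega>. restrict (\<lambda>l. X l \<omega>) {?j}))
        borel ((\<lambda>g. blinfun_apply (g ?k) w' - blinfun_apply \<mu> w') \<circ> (\<lambda>\<omega>. restrict (\<lambda>l. X l \<omega>) {?k}))"
      using i by (intro indep_var_compose[OF indep_var_restrict[OF indep]] f) auto
    then have "indep_var borel (W ?j w) borel (W ?k w')"
      by (simp add: comp_def W_def[abs_def])
    from expectation_inner_indep[OF this W_bound[OF jk(1)] W_bound[OF jk(2)]]
    show ?thesis using W_mean[OF jk(1)] by simp
  qed
  have "expectation (\<lambda>\<omega>. blinfun_apply (Y i \<omega>) u \<bullet> v)
      = expectation (\<lambda>\<omega>. (1/2) * (W ?j u \<omega> \<bullet> W ?j v \<omega> + W ?k u \<omega> \<bullet> W ?k v \<omega>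
          - W ?j u \<omega> \<bullet> W ?k v \<omega> - W ?j v \<omega> \<bullet> W ?k u \<omega>))"
    by (intro Bochner_Integration.integral_cong refl, subst Y_inner[OF i])
      (auto simp: W_def inner_diff inner_commute)
  also have "\<dots> = (1/2) * (blinfun_apply S u \<bullet> v + blinfun_apply S u \<bullet> v)"
    using W_int jk cross S_inner[OF jk(1), of u v] S_inner[OF jk(2), of u v]
    by (simp add: W_def[abs_def])
  finally show ?thesis by simp
qed

lemma X_pair_apply_measurable:
  "(\<lambda>p. blinfun_apply (fst p) u - blinfun_apply (snd p) u)
    \<in> borel_measurable (borel \<Otimes>\<^sub>M (borel :: ('a \<Rightarrow>\<^sub>L 'a) measure))"
  by (intro borel_measurable_diff borel_measurable_blinfun_apply measurable_fst measurable_snd)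

text \<open>
  The space of operators is not second countable in general, so a statistic \<open>g (Y i)\<close> need
  not be a measurable function of a pair of operators with respect to the product of the Borel
  sigma algebras.  The formulas \<open>f\<close> used below depend on the operators only through images
  of vectors, which makes them measurable; they agree with \<open>g\<close> for self-adjoint operators.
\<close>

lemma AE_paired_average_tendsto:
  fixes f :: "('a \<Rightarrow>\<^sub>L 'a) \<times> ('a \<Rightarrow>\<^sub>L 'a) \<Rightarrow> real" and g :: "('a \<Rightarrow>\<^sub>L 'a) \<Rightarrow> real"
  assumes f: "f \<in> borel_measurable (borel \<Otimes>\<^sub>M borel)"
    and g: "\<And>i \<omega>. i \<ge> 1 \<Longrightarrow> \<omega> \<in> space M \<Longrightarrow> g (Y i \<omega>) = f (X (2 * i - 1) \<omega>, X (2 * i) \<omega>)"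
    and bound: "\<And>i. i \<ge> 1 \<Longrightarrow> AE \<omega> in M. \<bar>g (Y i \<omega>)\<bar> \<le> b"
    and mean: "\<And>i. i \<ge> 1 \<Longrightarrow> expectation (\<lambda>\<omega>. g (Y i \<omega>)) = m"
  shows "AE \<omega> in M. (\<lambda>n. (\<Sum>i = 1..n. g (Y i \<omega>)) / real n) \<longlonglongrightarrow> m"
proof -
  let ?Z = "\<lambda>i \<omega>. f (X (2 * i - 1) \<omega>, X (2 * i) \<omega>)"
  have "AE \<omega> in M. (\<lambda>n. (\<Sum>i = 1..n. ?Z i \<omega>) / real n) \<longlonglongrightarrow> m"
  proof (rule strong_law_bounded)
    show "indep_vars (\<lambda>_. borel) ?Z {1..}"
      by (rule indep_vars_consecutive_pairs[OF indep f])
    show "AE \<omega> in M. \<bar>?Z i \<omega>\<bar> \<le> b" if "i \<ge> 1" for i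
      using bound[OF that] AE_space by eventually_elim (simp add: g[OF that])
    show "expectation (?Z i) = m" if "i \<ge> 1" for i
      using mean[OF that] g[OF that] Bochner_Integration.integral_cong[OF refl, of M "?Z i" "\<lambda>\<omega>. g (Y i \<omega>)"]
      by simp
  qed
  then show ?thesis
    using AE_space
  proof eventually_elim
    case (elim \<omega>)
    have "(\<Sum>i = 1..n. g (Y i \<omega>)) = (\<Sum>i = 1..n. ?Z i \<omega>)" for n
      by (intro sum.cong refl g) (use elim in auto)
    then show ?case using elim by simp
  qed
qed

lemma AE_entries_tendsto:
  "AE \<omega> in M. (\<lambda>n. (\<Sum>i = 1..n. blinfun_apply (Y i \<omega>) u \<bullet> v) / real n) \<longlonglongrightarrow> blinfun_apply S u \<bullet> v"
proof (rule AE_paired_average_tendsto)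
  let ?f = "\<lambda>p :: ('a \<Rightarrow>\<^sub>L 'a) \<times> ('a \<Rightarrow>\<^sub>L 'a). (1/2) * ((blinfun_apply (fst p) u - blinfun_apply (snd p) u) \<bullet>
    (blinfun_apply (fst p) v - blinfun_apply (snd p) v))"
  show "?f \<in> borel_measurable (borel \<Otimes>\<^sub>M borel)"
    using X_pair_apply_measurable[of u] X_pair_apply_measurable[of v] by measurable
  show "blinfun_apply (Y i \<omega>) u \<bullet> v = ?f (X (2 * i - 1) \<omega>, X (2 * i) \<omega>)"
    if "i \<ge> 1" "\<omega> \<in> space M" for i \<omega>
    using Y_inner[OF that] by simp
  show "AE \<omega> in M. \<bar>blinfun_apply (Y i \<omega>) u \<bullet> v\<bar> \<le> 2 * c\<^sup>2 * norm u * norm v" if "i \<ge> 1" for i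
    using AE_norm_Y[OF that]
  proof eventually_elim
    case (elim \<omega>)
    have "\<bar>blinfun_apply (Y i \<omega>) u \<bullet> v\<bar> \<le> norm (blinfun_apply (Y i \<omega>) u) * norm v"
      by (rule Cauchy_Schwarz_ineq2)
    also have "\<dots> \<le> 2 * c\<^sup>2 * norm u * norm v"
      using elim by (intro mult_right_mono order_trans[OF norm_blinfun]) auto
    finally show ?case .
  qed
qed (rule expectation_Y_inner)

lemma ext_trace_Y:
  assumes "i \<ge> 1" "\<omega> \<in> space M"
  shows "ext_trace ip (Y i \<omega>) = (\<integral>\<^sup>+e. ennreal ((1/2) * (norm (blinfun_apply (X (2 * i - 1) \<omega>) e
    - blinfun_apply (X (2 * i) \<omega>) e))\<^sup>2) \<partial>count_space trace_basis)"
  unfolding ext_trace_eq_nn_integral power2_norm_eq_inner Y_inner[OF assms] ..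

text \<open>The expectation and the sum over the countable basis are exchanged by monotone convergence.\<close>

lemma nn_integral_ext_trace_Y:
  assumes i: "i \<ge> 1"
  shows "(\<integral>\<^sup>+\<omega>. ext_trace ip (Y i \<omega>) \<partial>M) = ext_trace ip S"
proof -
  let ?h = "\<lambda>e \<omega>. ennreal ((1/2) * (norm (blinfun_apply (X (2 * i - 1) \<omega>) e
    - blinfun_apply (X (2 * i) \<omega>) e))\<^sup>2)"
  have meas: "(\<lambda>\<omega>. blinfun_apply (X j \<omega>) e) \<in> borel_measurable M" if "j \<ge> 1" for j e
    by (rule borel_measurable_blinfun_apply[OF X_measurable[OF that]])
  have [measurable]: "(\<lambda>\<omega>. blinfun_apply (X (2 * i - 1) \<omega>) e) \<in> borel_measurable M"
      "(\<lambda>\<omega>. blinfun_apply (X (2 * i) \<omega>) e) \<in> borel_measurable M" for e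
    using i by (auto intro!: meas)
  have h: "(\<integral>\<^sup>+\<omega>. ?h e \<omega> \<partial>M) = ennreal (blinfun_apply S e \<bullet> e)" for e
  proof -
    have eq: "blinfun_apply (Y i \<omega>) e \<bullet> e = (1/2) * (norm (blinfun_apply (X (2 * i - 1) \<omega>) e
        - blinfun_apply (X (2 * i) \<omega>) e))\<^sup>2" if "\<omega> \<in> space M" for \<omega>
      using Y_inner[OF i that] by (simp add: power2_norm_eq_inner)
    have "integrable M (\<lambda>\<omega>. (1/2) * (norm (blinfun_apply (X (2 * i - 1) \<omega>) e
        - blinfun_apply (X (2 * i) \<omega>) e))\<^sup>2)"
    proof (rule integrable_norm_bounded)
      show "AE \<omega> in M. norm ((1/2) * (norm (blinfun_apply (X (2 * i - 1) \<omega>) e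
        - blinfun_apply (X (2 * i) \<omega>) e))\<^sup>2) \<le> 2 * c\<^sup>2 * (norm e)\<^sup>2"
        using AE_norm_Y[OF i] AE_space
      proof eventually_elim
        case (elim \<omega>)
        show ?case
          using quadratic_form_le_norm[of "Y i \<omega>" e] mult_right_mono[OF elim(1), of "(norm e)\<^sup>2"]
          unfolding eq[OF elim(2)] by simp
      qed
    qed measurable
    then have "(\<integral>\<^sup>+\<omega>. ?h e \<omega> \<partial>M) = ennreal (expectation (\<lambda>\<omega>. (1/2) *
        (norm (blinfun_apply (X (2 * i - 1) \<omega>) e - blinfun_apply (X (2 * i) \<omega>) e))\<^sup>2))"
      by (intro nn_integral_eq_integral) auto
    also have "expectation (\<lambda>\<omega>. (1/2) * (norm (blinfun_apply (X (2 * i - 1) \<omega>) e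
        - blinfun_apply (X (2 * i) \<omega>) e))\<^sup>2) = expectation (\<lambda>\<omega>. blinfun_apply (Y i \<omega>) e \<bullet> e)"
      by (intro Bochner_Integration.integral_cong refl) (simp add: eq)
    finally show ?thesis by (simp only: expectation_Y_inner[OF i])
  qed
  have "(\<integral>\<^sup>+\<omega>. ext_trace ip (Y i \<omega>) \<partial>M) = (\<integral>\<^sup>+\<omega>. (\<integral>\<^sup>+e. ?h e \<omega> \<partial>count_space trace_basis) \<partial>M)"
    by (intro nn_integral_cong ext_trace_Y i)
  also have "\<dots> = (\<integral>\<^sup>+e. (\<integral>\<^sup>+\<omega>. ?h e \<omega> \<partial>M) \<partial>count_space trace_basis)"
    by (rule nn_integral_count_space_nn_integral[OF countable_trace_basis]) measurable
  finally show ?thesis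
    unfolding h ext_trace_eq_nn_integral .
qed

lemma ext_trace_S_le: "ext_trace ip S \<le> ennreal (2 * B)"
proof -
  have "ext_trace ip S \<le> (\<integral>\<^sup>+\<omega>. ennreal (2 * B) \<partial>M)"
    unfolding nn_integral_ext_trace_Y[OF order_refl, symmetric]
    by (intro nn_integral_mono_AE AE_ext_trace_Y order_refl)
  then show ?thesis by (simp add: emeasure_space_1)
qed

lemma AE_trace_tendsto:
  "AE \<omega> in M. (\<lambda>n. (\<Sum>i = 1..n. op_tr ip (Y i \<omega>)) / real n) \<longlonglongrightarrow> op_tr ip S"
proof (rule AE_paired_average_tendsto)
  let ?f = "\<lambda>p :: ('a \<Rightarrow>\<^sub>L 'a) \<times> ('a \<Rightarrow>\<^sub>L 'a). enn2real (\<integral>\<^sup>+e. ennreal ((1/2) * (norm (blinfun_apply (fst p) e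
    - blinfun_apply (snd p) e))\<^sup>2) \<partial>count_space trace_basis)"
  interpret E: sigma_finite_measure "count_space trace_basis"
    by (rule sigma_finite_measure_count_space_countable[OF countable_trace_basis])
  have "(\<lambda>(p :: ('a \<Rightarrow>\<^sub>L 'a) \<times> ('a \<Rightarrow>\<^sub>L 'a), e). ennreal ((1/2) * (norm (blinfun_apply (fst p) e - blinfun_apply (snd p) e))\<^sup>2))
      \<in> borel_measurable ((borel \<Otimes>\<^sub>M (borel :: ('a \<Rightarrow>\<^sub>L 'a) measure)) \<Otimes>\<^sub>M count_space trace_basis)"
    by (subst measurable_pair_swap_iff, rule measurable_pair_measure_countable1[OF countable_trace_basis])
      (unfold prod.case, use X_pair_apply_measurable in measurable)
  then show f: "?f \<in> borel_measurable (borel \<Otimes>\<^sub>M borel)"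
    by (intro borel_measurable_enn2real E.borel_measurable_nn_integral)
  show f_eq: "op_tr ip (Y i \<omega>) = ?f (X (2 * i - 1) \<omega>, X (2 * i) \<omega>)" if "i \<ge> 1" "\<omega> \<in> space M" for i \<omega>
    unfolding op_tr_def ext_trace_Y[OF that] by simp
  show bound: "AE \<omega> in M. \<bar>op_tr ip (Y i \<omega>)\<bar> \<le> 2 * B" if "i \<ge> 1" for i
    using AE_ext_trace_Y[OF that] by eventually_elim (use op_tr_le B_pos op_tr_nonneg in force)
  show "expectation (\<lambda>\<omega>. op_tr ip (Y i \<omega>)) = op_tr ip S" if i: "i \<ge> 1" for i
  proof -
    have "(\<lambda>\<omega>. (X (2 * i - 1) \<omega>, X (2 * i) \<omega>)) \<in> measurable M (borel \<Otimes>\<^sub>M borel)"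
      using i by (intro measurable_Pair X_measurable) auto
    from measurable_compose[OF this f]
    have meas: "(\<lambda>\<omega>. op_tr ip (Y i \<omega>)) \<in> borel_measurable M"
      by (subst measurable_cong[OF f_eq[OF i]]) auto
    have "expectation (\<lambda>\<omega>. op_tr ip (Y i \<omega>)) = enn2real (\<integral>\<^sup>+\<omega>. ennreal (op_tr ip (Y i \<omega>)) \<partial>M)"
      using meas op_tr_nonneg by (intro integral_eq_nn_integral) auto
    also have "(\<integral>\<^sup>+\<omega>. ennreal (op_tr ip (Y i \<omega>)) \<partial>M) = (\<integral>\<^sup>+\<omega>. ext_trace ip (Y i \<omega>) \<partial>M)"
      using AE_ext_trace_Y[OF i]
      by (intro nn_integral_cong_AE, eventually_elim)
        (auto simp: op_tr_def intro!: ennreal_enn2real order_le_less_trans[OF _ ennreal_less_top])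
    finally show ?thesis
      unfolding nn_integral_ext_trace_Y[OF i] op_tr_def .
  qed
qed

end


section \<open>The empirical bound for a fixed sequence of observations\<close>

abbreviation (input) along_multiples_of_4 :: "nat filter" where
  "along_multiples_of_4 \<equiv> inf sequentially (principal {n. 4 dvd n})"

lemma tendsto_along_multiples_of_4:
  "(f \<longlongrightarrow> l) sequentially \<Longrightarrow> (f \<longlongrightarrow> l) along_multiples_of_4"
  by (rule tendsto_mono[OF inf_le1])

lemma eventually_along_multiples_of_4:
  "\<forall>\<^sub>F n in along_multiples_of_4. 4 dvd n \<and> N \<le> n"
  unfolding eventually_inf_principal using eventually_ge_at_top[of N] by eventually_elim auto

lemma tendsto_half_along_multiples_of_4:
  assumes "(f \<longlongrightarrow> l) sequentially"
  shows "((\<lambda>n. f (n div 2)) \<longlongrightarrow> l) along_multiples_of_4"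
proof (rule filterlim_compose[OF assms], rule filterlim_mono[OF _ order_refl inf_le1])
  show "filterlim (\<lambda>n::nat. n div 2) sequentially sequentially"
    unfolding filterlim_at_top
  proof
    fix Z :: nat
    show "\<forall>\<^sub>F n in sequentially. Z \<le> n div 2"
      using eventually_ge_at_top[of "2 * Z"] by eventually_elim auto
  qed
qed

lemma sample_variance_bounds:
  assumes "2 \<le> m" "\<And>i. 1 \<le> i \<Longrightarrow> 0 \<le> Z i" "\<And>i. 1 \<le> i \<Longrightarrow> Z i \<le> b"
  shows "0 \<le> sample_variance m Z" "sample_variance m Z \<le> 2 * b\<^sup>2"
proof -
  let ?I = "{(i, j). 1 \<le> i \<and> i < j \<and> j \<le> m}"
  let ?s = "\<Sum>(i, j)\<in>?I. (Z i - Z j)\<^sup>2"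
  have s0: "0 \<le> ?s" by (intro sum_nonneg) auto
  have "?s \<le> (\<Sum>(i, j)\<in>{1..m} \<times> {1..m}. (Z i - Z j)\<^sup>2)"
    by (intro sum_mono2) auto
  also have "\<dots> \<le> (\<Sum>(i, j)\<in>{1..m} \<times> {1..m}. b\<^sup>2)"
  proof (intro sum_mono, clarify)
    fix i j assume "i \<in> {1..m}" "j \<in> {1..m}"
    then have "\<bar>Z i - Z j\<bar> \<le> b" using assms(2,3)[of i] assms(2,3)[of j] by auto
    then show "(Z i - Z j)\<^sup>2 \<le> b\<^sup>2" by (metis abs_ge_zero power2_abs power_mono)
  qed
  also have "\<dots> = (real m)\<^sup>2 * b\<^sup>2" by (simp add: power2_eq_square)
  finally have s: "?s \<le> (real m)\<^sup>2 * b\<^sup>2" .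
  have "(real m)\<^sup>2 \<le> 2 * (real m * (real m - 1))"
    using mult_right_mono[of 2 "real m" "real m"] assms(1) by (simp add: power2_eq_square algebra_simps)
  then have "?s \<le> 2 * (real m * (real m - 1)) * b\<^sup>2"
    using s by (meson mult_right_mono order_trans zero_le_power2)
  moreover have pos: "0 < real m * (real m - 1)" using assms(1) by simp
  ultimately show "sample_variance m Z \<le> 2 * b\<^sup>2"
    unfolding sample_variance_def times_divide_eq_left mult_1_left pos_divide_le_eq[OF pos]
    by (simp only: mult_ac)
  show "0 \<le> sample_variance m Z"
    unfolding sample_variance_def using s0 pos by simp
qed

lemma sample_sd_bounds:
  assumes "2 \<le> m" "\<And>i. 1 \<le> i \<Longrightarrow> 0 \<le> Z i" "\<And>i. 1 \<le> i \<Longrightarrow> Z i \<le> b"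
  shows "0 \<le> sample_sd m Z" "sample_sd m Z \<le> sqrt 2 * b"
proof -
  have "sample_sd m Z \<le> sqrt (2 * b\<^sup>2)"
    using sample_variance_bounds[OF assms] by (simp add: sample_sd_def)
  also have "\<dots> = sqrt 2 * b"
    using assms(2,3)[of 1] by (simp add: real_sqrt_mult)
  finally show "sample_sd m Z \<le> sqrt 2 * b" .
  show "0 \<le> sample_sd m Z"
    using sample_variance_bounds[OF assms] by (simp add: sample_sd_def)
qed

locale observed_operators = separable_hilbert_space K scale ip
  for K :: "complex set"
    and scale :: "complex \<Rightarrow> 'a \<Rightarrow> 'a::{real_inner, banach, second_countable_topology}"
    and ip :: "'a \<Rightarrow> 'a \<Rightarrow> complex" +
  fixes x :: "nat \<Rightarrow> 'a \<Rightarrow>\<^sub>L 'a" and c B :: real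
  assumes selfadjoint_x: "\<And>i. 1 \<le> i \<Longrightarrow> selfadjoint_op ip (x i)"
    and norm_x: "\<And>i. 1 \<le> i \<Longrightarrow> norm (x i) \<le> c"
    and ext_trace_x: "\<And>i. 1 \<le> i \<Longrightarrow> ext_trace ip (op_sq (x i)) \<le> ennreal B"
    and c_pos: "0 < c" and B_pos: "0 < B"
begin

lemma positive_op_paired_x: "1 \<le> i \<Longrightarrow> positive_op (paired x i)"
  by (intro positive_op_paired selfadjoint_x) auto

lemma ext_trace_paired_x: "1 \<le> i \<Longrightarrow> ext_trace ip (paired x i) \<le> ennreal (2 * B)"
  using B_pos by (intro ext_trace_paired_le selfadjoint_x ext_trace_x) auto

lemma op_tr_paired_x: "1 \<le> i \<Longrightarrow> op_tr ip (paired x i) \<le> 2 * B"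
  using ext_trace_paired_x op_tr_le B_pos by simp

lemma positive_op_paired_paired_x: "1 \<le> i \<Longrightarrow> positive_op (paired (paired x) i)"
  by (intro positive_op_paired positive_op_selfadjoint[OF positive_op_paired_x]) auto

lemma ext_trace_paired_paired_x:
  assumes "1 \<le> i"
  shows "ext_trace ip (paired (paired x) i) \<le> ennreal (8 * B * c\<^sup>2)"
proof -
  have sq: "ext_trace ip (op_sq (paired x j)) \<le> ennreal (4 * B * c\<^sup>2)" if "1 \<le> j" for j
  proof -
    have "ext_trace ip (op_sq (paired x j)) \<le> ennreal (norm (paired x j)) * ext_trace ip (paired x j)"
      by (rule ext_trace_op_sq_le[OF positive_op_paired_x[OF that]])
    also have "\<dots> \<le> ennreal (2 * c\<^sup>2) * ennreal (2 * B)"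
      using that by (intro mult_mono ennreal_leI norm_paired_le norm_x ext_trace_paired_x) auto
    also have "\<dots> = ennreal (4 * B * c\<^sup>2)"
      using B_pos by (simp flip: ennreal_mult add: mult_ac)
    finally show ?thesis .
  qed
  have "ext_trace ip (paired (paired x) i) \<le> ennreal (2 * (4 * B * c\<^sup>2))"
    using assms B_pos
    by (intro ext_trace_paired_le positive_op_selfadjoint[OF positive_op_paired_x] sq) auto
  then show ?thesis by (simp add: mult.assoc)
qed

lemma op_tr_paired_paired_x: "1 \<le> i \<Longrightarrow> op_tr ip (paired (paired x) i) \<le> 8 * B * c\<^sup>2"
  using ext_trace_paired_paired_x op_tr_le B_pos by simp

lemma Sigma_hat_trace:
  shows op_tr_Sigma_hat: "op_tr ip (Sigma_hat n x) = 2 / real n * (\<Sum>i = 1..n div 2. op_tr ip (paired x i))"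
    and ext_trace_Sigma_hat_finite: "ext_trace ip (Sigma_hat n x) < \<infinity>"
proof -
  note finite = order_le_less_trans[OF ext_trace_paired_x ennreal_less_top]
  show "op_tr ip (Sigma_hat n x) = 2 / real n * (\<Sum>i = 1..n div 2. op_tr ip (paired x i))"
    unfolding Sigma_hat_def using finite by (intro op_tr_scaleR_sum(1) positive_op_paired_x; simp)
  show "ext_trace ip (Sigma_hat n x) < \<infinity>"
    unfolding Sigma_hat_def using finite by (intro op_tr_scaleR_sum(2) positive_op_paired_x; simp)
qed

lemma positive_op_Sigma_hat: "positive_op (Sigma_hat n x)"
  unfolding Sigma_hat_def by (intro positive_op_scaleR positive_op_sum positive_op_paired_x) auto

lemma op_tr_Sigma_hat'_le: "op_tr ip (Sigma_hat' n x) \<le> 8 * B * c\<^sup>2"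
proof -
  have "op_tr ip (Sigma_hat' n x) = 4 / real n * (\<Sum>i = 1..n div 4. op_tr ip (paired (paired x) i))"
    unfolding Sigma_hat'_def
    using order_le_less_trans[OF ext_trace_paired_paired_x ennreal_less_top]
    by (intro op_tr_scaleR_sum(1) positive_op_paired_paired_x; simp)
  also have "\<dots> \<le> 4 / real n * (\<Sum>i = 1..n div 4. 8 * B * c\<^sup>2)"
    by (intro mult_left_mono sum_mono op_tr_paired_paired_x) auto
  also have "\<dots> = (4 / real n * real (n div 4)) * (8 * B * c\<^sup>2)"
    by simp
  also have "\<dots> \<le> 1 * (8 * B * c\<^sup>2)"
  proof (intro mult_right_mono)
    have "4 * real (n div 4) \<le> real n" by linarith
    then show "4 / real n * real (n div 4) \<le> 1" by (cases "n = 0") simp_all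
  qed (use B_pos in simp)
  finally show ?thesis by simp
qed

text \<open>
  The traces of the pairs lie in \<open>[0, 2 B]\<close>, so their standard deviation is bounded and its
  factor of order \<open>sqrt (ln n / n)\<close> makes the deviation term vanish.
\<close>

lemma tau_u_tendsto:
  assumes \<delta>: "0 < \<delta>" and tr: "((\<lambda>n. op_tr ip (Sigma_hat n x)) \<longlongrightarrow> t) along_multiples_of_4"
  shows "((\<lambda>n. tau_u ip B n x (\<delta> / real n)) \<longlongrightarrow> t) along_multiples_of_4"
proof -
  let ?r = "\<lambda>n. sqrt (2 * ln (2 / (\<delta> / real n)) / (real n / 2))"
  have "(?r \<longlongrightarrow> 0) sequentially"
    using \<delta> by real_asymp
  then have "((\<lambda>n. (sqrt 2 * (2 * B)) * ?r n) \<longlongrightarrow> (sqrt 2 * (2 * B)) * 0) along_multiples_of_4"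
    by (intro tendsto_mult_left tendsto_along_multiples_of_4)
  then have upper: "((\<lambda>n. (sqrt 2 * (2 * B)) * ?r n) \<longlongrightarrow> 0) along_multiples_of_4"
    by simp
  have r: "0 \<le> ?r n" if "\<delta> * 2 \<le> real n" "1 \<le> n" for n
    using that \<delta> by (simp add: field_simps)
  obtain N where N: "\<delta> * 2 \<le> real N" using real_arch_simple by blast
  have "((\<lambda>n. sample_sd (n div 2) (\<lambda>i. op_tr ip (paired x i)) * ?r n) \<longlongrightarrow> 0) along_multiples_of_4"
  proof (rule tendsto_sandwich[OF _ _ tendsto_const upper])
    show "\<forall>\<^sub>F n in along_multiples_of_4. 0 \<le> sample_sd (n div 2) (\<lambda>i. op_tr ip (paired x i)) * ?r n"
      using eventually_along_multiples_of_4[of "max N 4"]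
    proof eventually_elim
      case (elim n)
      then have "0 \<le> sample_sd (n div 2) (\<lambda>i. op_tr ip (paired x i))"
        by (intro sample_sd_bounds[where b = "2 * B"] op_tr_nonneg op_tr_paired_x) auto
      then show ?case using elim N by (intro mult_nonneg_nonneg r) auto
    qed
    show "\<forall>\<^sub>F n in along_multiples_of_4. sample_sd (n div 2) (\<lambda>i. op_tr ip (paired x i)) * ?r n
        \<le> (sqrt 2 * (2 * B)) * ?r n"
      using eventually_along_multiples_of_4[of "max N 4"]
    proof eventually_elim
      case (elim n)
      then have "sample_sd (n div 2) (\<lambda>i. op_tr ip (paired x i)) \<le> sqrt 2 * (2 * B)"
        by (intro sample_sd_bounds[where b = "2 * B"] op_tr_nonneg op_tr_paired_x) auto
      then show ?case using elim N by (intro mult_right_mono r) auto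
    qed
  qed
  moreover have "((\<lambda>n. 7 * (2 * B) * ln (2 / (\<delta> / real n)) / (3 * (real n / 2 - 1))) \<longlongrightarrow> 0) along_multiples_of_4"
    by (rule tendsto_along_multiples_of_4) (use \<delta> in real_asymp)
  ultimately show ?thesis
    unfolding tau_u_def using tendsto_add[OF tendsto_add[OF tr]] by fastforce
qed

text \<open>
  The traces of the second-order pairs are at most \<open>8 B c\<^sup>2\<close>, so \<open>tau_u'\<close> stays
  bounded, and it enters \<open>Gamma_dev\<close> with a factor of order \<open>ln n / n\<close>.
\<close>

lemma Gamma_dev_tendsto_0:
  assumes \<delta>: "0 < \<delta>" "\<delta> < 1"
  shows "((\<lambda>n. Gamma_dev c n (\<delta> / real n / 2) (tau_u' ip B c n x (\<delta> / real n / 2))) \<longlongrightarrow> 0)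
    along_multiples_of_4"
proof -
  define b where "b = 8 * B * c\<^sup>2"
  have b: "0 \<le> b" using B_pos by (simp add: b_def)
  let ?l = "\<lambda>n. ln (2 / (\<delta> / real n / 2))"
  let ?\<tau> = "\<lambda>n. tau_u' ip B c n x (\<delta> / real n / 2)"
  let ?U = "\<lambda>n. b + sqrt 2 * b * sqrt (2 * ?l n / (real n / 4))
    + 7 * (4 * B * c\<^sup>2) * ?l n / (3 * (real n / 4 - 1))"
  have bounds: "0 \<le> ?\<tau> n \<and> ?\<tau> n \<le> ?U n \<and> 0 \<le> ?l n" if n: "8 \<le> n" for n
  proof -
    have l: "0 \<le> ?l n" using n \<delta> by (simp add: field_simps)
    have "0 \<le> sample_sd (n div 4) (\<lambda>i. op_tr ip (paired (paired x) i)) \<and>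
      sample_sd (n div 4) (\<lambda>i. op_tr ip (paired (paired x) i)) \<le> sqrt 2 * b"
      unfolding b_def using n
      by (intro conjI sample_sd_bounds[where b = "8 * B * c\<^sup>2"] op_tr_nonneg op_tr_paired_paired_x) auto
    moreover have "0 \<le> sqrt (2 * ?l n / (real n / 4))" using l by simp
    moreover have "0 \<le> 7 * (4 * B * c\<^sup>2) * ?l n / (3 * (real n / 4 - 1))"
      using l n B_pos by (intro divide_nonneg_nonneg mult_nonneg_nonneg) auto
    ultimately show ?thesis
      unfolding tau_u'_def using op_tr_Sigma_hat'_le[of n] op_tr_nonneg[of "Sigma_hat' n x"] l
      by (auto simp: b_def intro!: add_mono add_nonneg_nonneg mult_right_mono)
  qed
  have upper: "((\<lambda>n. 2 * ?U n / (real n / 2) * ?l n) \<longlongrightarrow> 0) along_multiples_of_4"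
    by (rule tendsto_along_multiples_of_4) (use \<delta> in real_asymp)
  have "((\<lambda>n. 2 * ?\<tau> n / (real n / 2) * ?l n) \<longlongrightarrow> 0) along_multiples_of_4"
  proof (rule tendsto_sandwich[OF _ _ tendsto_const upper])
    show "\<forall>\<^sub>F n in along_multiples_of_4. 0 \<le> 2 * ?\<tau> n / (real n / 2) * ?l n"
      using eventually_along_multiples_of_4[of 8]
      by eventually_elim (use bounds in auto)
    show "\<forall>\<^sub>F n in along_multiples_of_4. 2 * ?\<tau> n / (real n / 2) * ?l n \<le> 2 * ?U n / (real n / 2) * ?l n"
      using eventually_along_multiples_of_4[of 8]
    proof eventually_elim
      case (elim n)
      then show ?case
        using bounds[of n] by (intro mult_right_mono divide_right_mono mult_left_mono) auto
    qed
  qed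
  then have "((\<lambda>n. sqrt (2 * ?\<tau> n / (real n / 2) * ?l n)) \<longlongrightarrow> sqrt 0) along_multiples_of_4"
    by (rule tendsto_real_sqrt)
  moreover have "((\<lambda>n. 2 * c\<^sup>2 / (3 * (real n / 2)) * ?l n) \<longlongrightarrow> 0) along_multiples_of_4"
    by (rule tendsto_along_multiples_of_4) (use \<delta> in real_asymp)
  ultimately show ?thesis
    unfolding Gamma_dev_def using tendsto_add by fastforce
qed

lemma R_bound_tendsto:
  assumes \<delta>: "0 < \<delta>" "\<delta> < 1" and s: "0 < s" "s \<le> t"
    and norm: "((\<lambda>n. norm (Sigma_hat n x)) \<longlongrightarrow> s) along_multiples_of_4"
    and tr: "((\<lambda>n. op_tr ip (Sigma_hat n x)) \<longlongrightarrow> t) along_multiples_of_4"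
  shows "((\<lambda>n. sqrt (real n) * R_bound ip B c n x ((real n - 2) * \<delta> / real n) (\<delta> / real n) (\<delta> / real n))
    \<longlongrightarrow> sqrt (2 * s * ln (2 / \<delta> * (t / s)))) along_multiples_of_4"
proof -
  let ?s2 = "\<lambda>n. sigma_u_sq ip B c n x (\<delta> / real n)"
  define L where "L n = ln (2 / ((real n - 2) * \<delta> / real n) *
    max (tau_u ip B n x (\<delta> / real n) / ?s2 n) 1)" for n
  have s2: "(?s2 \<longlongrightarrow> s) along_multiples_of_4"
    unfolding sigma_u_sq_def sigma_u_sq_at_def
    using tendsto_add[OF norm Gamma_dev_tendsto_0[OF \<delta>]] by simp
  have "((\<lambda>n. (real n - 2) * \<delta> / real n) \<longlongrightarrow> \<delta>) along_multiples_of_4"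
    by (rule tendsto_along_multiples_of_4) (use \<delta> in real_asymp)
  then have "((\<lambda>n. 2 / ((real n - 2) * \<delta> / real n)) \<longlongrightarrow> 2 / \<delta>) along_multiples_of_4"
    using \<delta> by (intro tendsto_divide tendsto_const) auto
  moreover have "((\<lambda>n. max (tau_u ip B n x (\<delta> / real n) / ?s2 n) 1) \<longlongrightarrow> max (t / s) 1) along_multiples_of_4"
    using s by (intro tendsto_max tendsto_divide tau_u_tendsto \<delta> tr s2 tendsto_const) auto
  moreover have "max (t / s) 1 = t / s" using s by (simp add: max_def)
  ultimately have L: "(L \<longlongrightarrow> ln (2 / \<delta> * (t / s))) along_multiples_of_4"
    unfolding L_def using s \<delta> by (intro tendsto_ln tendsto_mult) auto
  have "((\<lambda>n. 1 / sqrt (real n)) \<longlongrightarrow> 0) along_multiples_of_4"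
    by (rule tendsto_along_multiples_of_4) real_asymp
  then have "((\<lambda>n. sqrt (?s2 n) * sqrt (2 * L n) + 2 * c / 3 * L n * (1 / sqrt (real n)))
      \<longlongrightarrow> sqrt s * sqrt (2 * ln (2 / \<delta> * (t / s))) + 2 * c / 3 * ln (2 / \<delta> * (t / s)) * 0)
      along_multiples_of_4"
    by (intro tendsto_intros s2 L)
  then have "((\<lambda>n. sqrt (?s2 n) * sqrt (2 * L n) + 2 * c / 3 * L n * (1 / sqrt (real n)))
      \<longlongrightarrow> sqrt (2 * s * ln (2 / \<delta> * (t / s)))) along_multiples_of_4"
    by (simp add: real_sqrt_mult mult_ac)
  then show ?thesis
  proof (rule Lim_transform_eventually)
    show "\<forall>\<^sub>F n in along_multiples_of_4. sqrt (?s2 n) * sqrt (2 * L n) + 2 * c / 3 * L n * (1 / sqrt (real n))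
      = sqrt (real n) * R_bound ip B c n x ((real n - 2) * \<delta> / real n) (\<delta> / real n) (\<delta> / real n)"
      using eventually_along_multiples_of_4[of 1]
    proof eventually_elim
      case (elim n)
      then have n: "0 < real n" by simp
      have "sqrt (real n) * sqrt (2 / real n * L n) = sqrt (2 * L n)"
        using n by (simp flip: real_sqrt_mult)
      moreover have "sqrt (real n) * (2 * c / (3 * real n) * L n) = 2 * c / 3 * L n * (1 / sqrt (real n))"
        using n by (simp add: field_simps flip: power2_eq_square)
      ultimately show ?case
        unfolding R_bound_def Let_def L_def[symmetric] by (simp add: distrib_left mult.left_commute)
    qed
  qed
qed

end

lemma (in random_operator_sequence) AE_norm_and_trace_Sigma_hat_tendsto:
  assumes c: "0 < c"
  shows "AE \<omega> in M. observed_operators K scale ip (\<lambda>i. X i \<omega>) c B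
    \<and> ((\<lambda>n. norm (Sigma_hat n (\<lambda>i. X i \<omega>))) \<longlongrightarrow> norm S) along_multiples_of_4
    \<and> ((\<lambda>n. op_tr ip (Sigma_hat n (\<lambda>i. X i \<omega>))) \<longlongrightarrow> op_tr ip S) along_multiples_of_4"
proof -
  let ?V = "trace_basis \<union> scale \<i> ` trace_basis"
  have "AE \<omega> in M. \<forall>i\<in>{1..}. norm (X i \<omega>) \<le> c"
    by (subst AE_ball_countable) (auto intro: norm_bound)
  moreover have "AE \<omega> in M. \<forall>i\<in>{1..}. ext_trace ip (op_sq (X i \<omega>)) \<le> ennreal B"
    by (subst AE_ball_countable) (auto intro: trace_bound)
  moreover have "AE \<omega> in M. \<forall>(e, v)\<in>trace_basis \<times> ?V.
      (\<lambda>n. (\<Sum>i = 1..n. blinfun_apply (Y i \<omega>) e \<bullet> v) / real n) \<longlonglongrightarrow> blinfun_apply S e \<bullet> v"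
    by (subst AE_ball_countable) (use AE_entries_tendsto countable_trace_basis in auto)
  moreover note AE_trace_tendsto AE_space
  ultimately show ?thesis
  proof eventually_elim
    case (elim \<omega>)
    interpret observed_operators K scale ip "\<lambda>i. X i \<omega>" c B
      by unfold_locales (use elim selfadjoint c B_pos in auto)
    let ?\<Sigma> = "\<lambda>n. Sigma_hat n (\<lambda>i. X i \<omega>)"
    \<comment> \<open>For even \<open>n\<close> the paired sample variance is the average of its \<open>n div 2\<close> summands.\<close>
    have half: "2 / real n = 1 / real (n div 2)" if "4 dvd n" for n
      using that by (auto elim!: dvdE)
    have tr: "((\<lambda>n. op_tr ip (?\<Sigma> n)) \<longlongrightarrow> op_tr ip S) along_multiples_of_4"
    proof (rule Lim_transform_eventually[OF tendsto_half_along_multiples_of_4[OF elim(4)]])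
      show "\<forall>\<^sub>F n in along_multiples_of_4.
          (\<Sum>i = 1..n div 2. op_tr ip (Y i \<omega>)) / real (n div 2) = op_tr ip (?\<Sigma> n)"
        using eventually_along_multiples_of_4[of 0]
        by eventually_elim (simp add: op_tr_Sigma_hat half)
    qed
    have entry: "((\<lambda>n. blinfun_apply (?\<Sigma> n) e \<bullet> v) \<longlongrightarrow> blinfun_apply S e \<bullet> v) along_multiples_of_4"
      if "e \<in> trace_basis" "v \<in> ?V" for e v
    proof (rule Lim_transform_eventually[OF tendsto_half_along_multiples_of_4])
      show "(\<lambda>n. (\<Sum>i = 1..n. blinfun_apply (Y i \<omega>) e \<bullet> v) / real n) \<longlonglongrightarrow> blinfun_apply S e \<bullet> v"
        using elim(3) that by blast
      show "\<forall>\<^sub>F n in along_multiples_of_4.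
          (\<Sum>i = 1..n div 2. blinfun_apply (Y i \<omega>) e \<bullet> v) / real (n div 2) = blinfun_apply (?\<Sigma> n) e \<bullet> v"
        using eventually_along_multiples_of_4[of 0]
        by eventually_elim (simp add: Sigma_hat_def half blinfun.bilinear_simps blinfun.sum_left inner_sum_left)
    qed
    have "((\<lambda>n. norm (?\<Sigma> n)) \<longlongrightarrow> norm S) along_multiples_of_4"
    proof (rule norm_tendsto_if_entries_and_trace_tendsto[OF positive_op_Sigma_hat ext_trace_Sigma_hat_finite positive_op_S _ _ tr])
      show "ext_trace ip S < \<infinity>"
        using ext_trace_S_le by (auto intro: order_le_less_trans)
      fix e f assume ef: "e \<in> trace_basis" "f \<in> trace_basis"
      let ?d = "\<lambda>n v. blinfun_apply (?\<Sigma> n) e \<bullet> v - blinfun_apply S e \<bullet> v"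
      have "((\<lambda>n. \<bar>?d n f\<bar> + \<bar>?d n (scale \<i> f)\<bar>) \<longlongrightarrow> \<bar>blinfun_apply S e \<bullet> f - blinfun_apply S e \<bullet> f\<bar>
          + \<bar>blinfun_apply S e \<bullet> scale \<i> f - blinfun_apply S e \<bullet> scale \<i> f\<bar>) along_multiples_of_4"
        using ef by (intro tendsto_intros entry) auto
      then have lim: "((\<lambda>n. \<bar>?d n f\<bar> + \<bar>?d n (scale \<i> f)\<bar>) \<longlongrightarrow> 0) along_multiples_of_4" by simp
      have "((\<lambda>n. ip (blinfun_apply (?\<Sigma> n) e) f - ip (blinfun_apply S e) f) \<longlongrightarrow> 0) along_multiples_of_4"
      proof (rule Lim_null_comparison[OF always_eventually lim], rule allI)
        fix n
        show "norm (ip (blinfun_apply (?\<Sigma> n) e) f - ip (blinfun_apply S e) f)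
            \<le> \<bar>?d n f\<bar> + \<bar>?d n (scale \<i> f)\<bar>"
          using cmod_ip_le[of "blinfun_apply (?\<Sigma> n) e - blinfun_apply S e" f]
          by (simp add: ip_diff_left inner_diff_left)
      qed
      then show "((\<lambda>n. ip (blinfun_apply (?\<Sigma> n) e) f) \<longlongrightarrow> ip (blinfun_apply S e) f) along_multiples_of_4"
        by (rule LIM_zero_cancel)
    qed
    with tr show ?case
      using observed_operators_axioms by blast
  qed
qed

theorem theorem5p6:
  fixes K :: "complex set"
    and scale :: "complex \<Rightarrow> 'a \<Rightarrow> 'a::{real_inner, banach, second_countable_topology}"
    and ip :: "'a \<Rightarrow> 'a \<Rightarrow> complex"
    and M :: "'w measure"
    and X :: "nat \<Rightarrow> 'w \<Rightarrow> 'a \<Rightarrow>\<^sub>L 'a"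
    and \<mu> S S' :: "'a \<Rightarrow>\<^sub>L 'a"
    and c B \<delta> :: real
  assumes hilbert: "separable_hilbert_space K scale ip"
    and prob: "prob_space M"
    and indep: "prob_space.indep_vars M (\<lambda>_. borel) X {1..}"
    and compact: "\<And>i \<omega>. i \<ge> 1 \<Longrightarrow> \<omega> \<in> space M \<Longrightarrow> compact_op (X i \<omega>)"
    and selfadjoint: "\<And>i \<omega>. i \<ge> 1 \<Longrightarrow> \<omega> \<in> space M \<Longrightarrow> selfadjoint_op ip (X i \<omega>)"
    and c_pos: "c > 0" and B_pos: "B > 0"
    and norm_bound: "\<And>i. i \<ge> 1 \<Longrightarrow> AE \<omega> in M. norm (X i \<omega>) \<le> c"
    and trace_bound: "\<And>i. i \<ge> 1 \<Longrightarrow> AE \<omega> in M. ext_trace ip (op_sq (X i \<omega>)) \<le> ennreal B"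
    and mean: "\<And>i. i \<ge> 1 \<Longrightarrow> op_expectation M (X i) = \<mu>"
    and var: "\<And>i. i \<ge> 1 \<Longrightarrow> op_variance M (X i) = S"
    and var': "\<And>i. i \<ge> 1 \<Longrightarrow> op_variance M (\<lambda>\<omega>. op_sq (X i \<omega> - \<mu>) - S) = S'"
    and S_nonzero: "S \<noteq> 0"
    and delta: "0 < \<delta>" "\<delta> < 1"
  shows "AE \<omega> in M.
    ((\<lambda>n. sqrt (real n) *
          R_bound ip B c n (\<lambda>i. X i \<omega>) ((real n - 2) * \<delta> / real n) (\<delta> / real n) (\<delta> / real n))
      \<longlongrightarrow> sqrt (2 * norm S * ln (2 / \<delta> * (op_tr ip S / norm S))))
    (inf sequentially (principal {n. 4 dvd n}))"
proof -
  interpret separable_hilbert_space K scale ip by (rule hilbert)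
  interpret prob_space M by (rule prob)
  interpret random_operator_sequence K scale ip M X \<mu> S c B
    by unfold_locales (fact indep selfadjoint B_pos norm_bound trace_bound mean var)+
  have "norm S \<le> op_tr ip S"
    using ext_trace_S_le by (intro norm_le_op_tr positive_op_S) (auto intro: order_le_less_trans)
  moreover have "0 < norm S" using S_nonzero by simp
  ultimately show ?thesis
    using AE_norm_and_trace_Sigma_hat_tendsto[OF c_pos]
    by (elim eventually_mono) (intro observed_operators.R_bound_tendsto[where K = K and scale = scale] delta; simp)
qed

end
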